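(* Let $\alpha\in[0,\infty)$ and let $L$ be the event that $\mathscr{G}(n,\alpha/n)$ contains no cycles. Then the limit below exists and \[ \lim_{n\to\infty}P_{n,\alpha}(L)^{1/n}=\begin{cases}\alpha\exp\bigl(-\tfrac{\alpha}{2}+\tfrac{1}{2\alpha}\bigr), & \text{if }\alpha>1,\\ 1, & \text{otherwise.}\end{cases} \]
   Context: $\mathscr{G}(n,p)$ is the random graph on vertex set $\{1,\dots,n\}$ in which each of the $\binom n2$ unordered pairs is an edge independently with probability $p$; here $p=\alpha/n$, and $P_{n,\alpha}$ is the corresponding probability measure. *)

theory Defs
  imports "HOL-Analysis.Analysis"
begin

definition all_pairs :: "nat \<Rightarrow> nat set set" where
  "all_pairs n = {e. e \<subseteq> {1..n} \<and> card e = 2}"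

definition has_cycle :: "nat set set \<Rightarrow> bool" where
  "has_cycle E \<longleftrightarrow> (\<exists>vs. length vs \<ge> 3 \<and> distinct vs \<and>
      (\<forall>i < length vs - 1. {vs ! i, vs ! Suc i} \<in> E) \<and> {last vs, hd vs} \<in> E)"

definition graph_acyclic :: "nat set set \<Rightarrow> bool" where
  "graph_acyclic E \<longleftrightarrow> \<not> has_cycle E"

text \<open>Probability of an event Q (a property of edge sets) in G(n,p): each of the
  binom(n,2) pairs is an edge independently with probability p.\<close>
definition gnp_prob :: "nat \<Rightarrow> real \<Rightarrow> (nat set set \<Rightarrow> bool) \<Rightarrow> real" where
  "gnp_prob n p Q = (\<Sum>E \<in> {E. E \<subseteq> all_pairs n \<and> Q E}.
      p ^ card E * (1 - p) ^ (card (all_pairs n) - card E))"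

end

theory Submission
  imports Defs "HOL-Real_Asymp.Real_Asymp"
begin

text \<open>
  With \<open>q = p / (1 - p)\<close> the probability of acyclicity is \<open>(1 - p)\<close> to the power \<open>n choose 2\<close> times
  \<open>Z\<^sub>n(q)\<close>, the sum of \<open>q\<close> to the number of edges over all forests on \<open>n\<close> vertices, so the
  question is the growth of \<open>Z\<^sub>n(\<alpha> / n)\<close>.

  Upper bound for \<open>\<alpha> > 1\<close>: removing the component of a vertex gives a recursion for \<open>Z\<^sub>n\<close>, hence
  \<open>Z\<^sub>n(q) \<le> n! q\<^sup>n x\<^sup>-\<^sup>n exp (U(x) / q)\<close> where \<open>U\<close> is the exponential generating function of
  trees. Removing an edge of a tree gives \<open>U = T - T\<^sup>2 / 2 \<le> 1 / 2\<close> for the generating function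
  \<open>T\<close> of rooted trees, and one takes \<open>x = 1 / e\<close>.

  Lower bound for \<open>\<alpha> < 1\<close>: by Harris' inequality the probability that there is no cycle is at least
  the product over all potential cycles of the probability that this cycle is absent, which is
  bounded away from \<open>0\<close>.

  Lower bound for \<open>\<alpha> \<ge> 1\<close>: count only the forests made of a tree on about \<open>(1 - 1 / \<alpha>) n\<close>
  vertices (there are many by Cayley's formula) and a barely subcritical forest on the others.
\<close>

section \<open>Forests, trees and their decompositions\<close>

definition pairs :: "'a set \<Rightarrow> 'a set set" where
  "pairs S = {e. e \<subseteq> S \<and> card e = 2}"

definition reach :: "'a set set \<Rightarrow> ('a \<times> 'a) set" where
  "reach E = {(u, v). {u, v} \<in> E}\<^sup>*"

text \<open>Acyclicity is encoded as "every edge is a bridge", which suits cutting and joining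
  better than cycle lists; \<open>graph_acyclic_iff_forest\<close> gives the link to cycles.\<close>

definition forest :: "'a set set \<Rightarrow> bool" where
  "forest E \<longleftrightarrow> (\<forall>u v. {u, v} \<in> E \<longrightarrow> (u, v) \<notin> reach (E - {{u, v}}))"

definition forests :: "'a set \<Rightarrow> 'a set set set" where
  "forests S = {E. E \<subseteq> pairs S \<and> forest E}"

text \<open>These are the trees spanning all of \<open>S\<close>. Requiring \<open>S\<close>
  nonempty leaves no tree on the empty set, which is what makes the extreme terms of the later
  convolutions vanish.\<close>

definition trees :: "'a set \<Rightarrow> 'a set set set" where
  "trees S = {E \<in> forests S. S \<noteq> {} \<and> S \<times> S \<subseteq> reach E}"

lemma pairs_iff [simp]: "{u, v} \<in> pairs S \<longleftrightarrow> u \<in> S \<and> v \<in> S \<and> u \<noteq> v"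
  by (auto simp: pairs_def card_insert_if)

lemma pairs_obtain:
  assumes "e \<in> pairs S"
  obtains u v where "e = {u, v}" "u \<noteq> v" "u \<in> S" "v \<in> S"
  using assms by (auto simp: pairs_def card_2_iff)

lemma edgeD:
  assumes "{u, v} \<in> E" "E \<subseteq> pairs S" shows "u \<in> S" "v \<in> S" "u \<noteq> v"
  using subsetD[OF assms(2,1)] by simp_all

lemma finite_pairs [simp]: "finite S \<Longrightarrow> finite (pairs S)"
  by (simp add: pairs_def)

lemma card_pairs: "finite S \<Longrightarrow> card (pairs S) = card S choose 2"
  by (simp add: pairs_def n_subsets)

section \<open>Reachability in graphs given by edge sets\<close>

lemma reach_refl [simp]: "(u, u) \<in> reach E"
  by (simp add: reach_def)

lemma reach_edge: "{u, v} \<in> E \<Longrightarrow> (u, v) \<in> reach E"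
  by (auto simp: reach_def)

lemma reach_trans: "(u, v) \<in> reach E \<Longrightarrow> (v, w) \<in> reach E \<Longrightarrow> (u, w) \<in> reach E"
  by (auto simp: reach_def)

lemma reach_sym: "(u, v) \<in> reach E \<Longrightarrow> (v, u) \<in> reach E"
proof -
  have "sym ({(u, v). {u, v} \<in> E}\<^sup>*)"
    by (rule sym_rtrancl) (auto simp: sym_def insert_commute)
  then show "(u, v) \<in> reach E \<Longrightarrow> (v, u) \<in> reach E"
    by (auto simp: reach_def sym_def)
qed

lemma reach_from_imp_connected:
  assumes "\<And>a. a \<in> S \<Longrightarrow> (u, a) \<in> reach E" shows "S \<times> S \<subseteq> reach E"
proof clarify
  fix a b assume "a \<in> S" "b \<in> S"
  from reach_trans[OF reach_sym[OF assms] assms, OF this] show "(a, b) \<in> reach E" .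
qed

lemma reach_mono: "E \<subseteq> F \<Longrightarrow> (u, v) \<in> reach E \<Longrightarrow> (u, v) \<in> reach F"
  unfolding reach_def by (rule set_mp[OF rtrancl_mono]) auto

lemma reach_induct [consumes 1, case_names refl step]:
  assumes "(a, b) \<in> reach E" "P a"
    "\<And>x y. (a, x) \<in> reach E \<Longrightarrow> P x \<Longrightarrow> {x, y} \<in> E \<Longrightarrow> P y"
  shows "P b"
  using assms(1) unfolding reach_def
  by (induction rule: rtrancl_induct) (use assms(2,3) in \<open>auto simp: reach_def\<close>)

text \<open>Repeated passages through the new edge can be shortcut, so a single passage in one of
  the two directions suffices.\<close>

lemma reach_insert:
  assumes "(a, b) \<in> reach (insert {u, v} E)"
  shows "(a, b) \<in> reach E \<or> (a, u) \<in> reach E \<and> (v, b) \<in> reach E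
    \<or> (a, v) \<in> reach E \<and> (u, b) \<in> reach E"
  using assms
proof (induction rule: reach_induct)
  case (step x y)
  show ?case
  proof (cases "{x, y} \<in> E")
    case True
    then show ?thesis using step.IH reach_trans[OF _ reach_edge[OF True]] by auto
  next
    case False
    then have "x = u \<and> y = v \<or> x = v \<and> y = u"
      using step.hyps by (auto simp: doubleton_eq_iff)
    then show ?thesis using step.IH by auto
  qed
qed simp

text \<open>A walk that starts in \<open>A\<close> never meets an edge of \<open>F\<close>, since
  those edges live in the disjoint set \<open>B\<close>.\<close>

lemma reach_Un_disjoint:
  assumes "(a, b) \<in> reach (E \<union> F)" "a \<in> A" "E \<subseteq> pairs A" "F \<subseteq> pairs B" "A \<inter> B = {}"
  shows "b \<in> A \<and> (a, b) \<in> reach E"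
  using assms(1)
proof (induction rule: reach_induct)
  case (step x y)
  then have "{x, y} \<in> E"
    using assms(4,5) edgeD(1)[of x y F B] by auto
  then show ?case
    using step.IH assms(3) edgeD(2)[of x y E A] reach_edge[of x y E] reach_trans[of a x E y] by auto
qed (use assms in auto)

section \<open>Constructing forests, and components\<close>

lemma forest_subset:
  assumes "forest E" "F \<subseteq> E" shows "forest F"
  unfolding forest_def
proof (intro allI impI notI)
  fix u v assume uv: "{u, v} \<in> F" "(u, v) \<in> reach (F - {{u, v}})"
  have "F - {{u, v}} \<subseteq> E - {{u, v}}" using assms by auto
  from reach_mono[OF this uv(2)] show False
    using assms uv(1) by (auto simp: forest_def)
qed

text \<open>If an old edge \<open>{a, b}\<close> stopped being a bridge, the detour from
  \<open>a\<close> to \<open>b\<close> would have to use the new edge; together with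
  \<open>{a, b}\<close> the rest of the detour would join \<open>u\<close> to \<open>v\<close>
  inside \<open>E\<close>.\<close>

lemma forest_insert:
  assumes E: "forest E" and uv: "(u, v) \<notin> reach E"
  shows "forest (insert {u, v} E)"
  unfolding forest_def
proof (intro allI impI notI)
  fix a b assume ab: "{a, b} \<in> insert {u, v} E"
    and r: "(a, b) \<in> reach (insert {u, v} E - {{a, b}})"
  show False
  proof (cases "{a, b} = {u, v}")
    case True
    then have "(a, b) \<in> reach E"
      using r reach_mono[of "insert {u, v} E - {{a, b}}" E] by auto
    then show False
      using True uv reach_sym[of v u E] by (auto simp: doubleton_eq_iff)
  next
    case False
    define E' where "E' = E - {{a, b}}"
    have "{a, b} \<in> E" using False ab by auto
    then have nab: "(a, b) \<notin> reach E'" and abE: "(a, b) \<in> reach E" "(b, a) \<in> reach E"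
      using E reach_edge[of a b E] reach_sym[of a b E] by (auto simp: forest_def E'_def)
    have "insert {u, v} E - {{a, b}} = insert {u, v} E'"
      using False by (auto simp: E'_def)
    then have "(a, u) \<in> reach E' \<and> (v, b) \<in> reach E' \<or> (a, v) \<in> reach E' \<and> (u, b) \<in> reach E'"
      using reach_insert[of a b u v E'] r nab by auto
    then have "(a, u) \<in> reach E \<and> (v, b) \<in> reach E \<or> (a, v) \<in> reach E \<and> (u, b) \<in> reach E"
      using reach_mono[of E' E] by (auto simp: E'_def)
    then have "(u, v) \<in> reach E \<or> (v, u) \<in> reach E"
      using reach_trans[OF reach_trans[OF reach_sym[of a u E] abE(1)] reach_sym[of v b E]]
        reach_trans[OF reach_trans[OF reach_sym[of a v E] abE(1)] reach_sym[of u b E]] by auto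
    then show False using uv reach_sym[of v u E] by auto
  qed
qed

lemma forest_Un_disjoint:
  assumes "forest E" "forest F" and sub: "E \<subseteq> pairs A" "F \<subseteq> pairs B" and AB: "A \<inter> B = {}"
  shows "forest (E \<union> F)"
proof -
  have *: "(u, v) \<notin> reach (E \<union> F - {{u, v}})"
    if "forest E" "E \<subseteq> pairs A" "F \<subseteq> pairs B" "A \<inter> B = {}" "{u, v} \<in> E"
    for u v E F and A B :: "'a set"
  proof
    assume r: "(u, v) \<in> reach (E \<union> F - {{u, v}})"
    have u: "u \<in> A" "u \<noteq> v" using that edgeD[of u v E A] by blast+
    then have "{u, v} \<notin> F" using that edgeD[of u v F B] by blast
    then have "E \<union> F - {{u, v}} = (E - {{u, v}}) \<union> F" by auto
    then have "(u, v) \<in> reach (E - {{u, v}})"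
      using reach_Un_disjoint[of u v "E - {{u, v}}" F A B] r u that by auto
    then show False using that by (auto simp: forest_def)
  qed
  show ?thesis
    unfolding forest_def
  proof (intro allI impI)
    fix u v assume "{u, v} \<in> E \<union> F"
    then consider "{u, v} \<in> E" | "{u, v} \<in> F" by auto
    then show "(u, v) \<notin> reach (E \<union> F - {{u, v}})"
      using *[of E A F B u v] *[of F B E A u v] assms
      by cases (auto simp: Int_commute Un_commute)
  qed
qed

lemma reach_closed:
  assumes "(a, b) \<in> reach E" "E \<subseteq> pairs S" "a \<in> S" shows "b \<in> S"
  using reach_Un_disjoint[of a b E "{}" S "{}"] assms by auto

text \<open>No edge leaves \<open>C\<close>, because the endpoints of an edge reach each other.
  Walks therefore stay on their side, and connectivity can be tested within each part.\<close>

lemma component_split: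
  assumes E: "E \<subseteq> pairs S" and u: "u \<in> S" and C: "C = reach E `` {u}"
  shows "C \<subseteq> S" "u \<in> C" "E = E \<inter> pairs C \<union> E \<inter> pairs (S - C)"
    "C \<times> C \<subseteq> reach (E \<inter> pairs C)"
    "\<And>a b. a \<in> S - C \<Longrightarrow> (a, b) \<in> reach E \<Longrightarrow> (a, b) \<in> reach (E \<inter> pairs (S - C))"
proof -
  show CS: "C \<subseteq> S" using reach_closed[OF _ E u] by (auto simp: C)
  show uC: "u \<in> C" by (simp add: C)
  show split: "E = E \<inter> pairs C \<union> E \<inter> pairs (S - C)"
  proof (intro equalityI subsetI)
    fix e assume e: "e \<in> E"
    then obtain a b where ab: "e = {a, b}" "a \<noteq> b" "a \<in> S" "b \<in> S"
      using pairs_obtain[OF subsetD[OF E e]] by blast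
    have "(a, b) \<in> reach E" "(b, a) \<in> reach E"
      using e ab reach_edge[of a b E] reach_sym[of a b E] by auto
    then have "a \<in> C \<longleftrightarrow> b \<in> C"
      using reach_trans[of u a E b] reach_trans[of u b E a] by (auto simp: C)
    then show "e \<in> E \<inter> pairs C \<union> E \<inter> pairs (S - C)" using e ab by auto
  qed auto
  have "(u, a) \<in> reach (E \<inter> pairs C)" if "a \<in> C" for a
    using reach_Un_disjoint[of u a "E \<inter> pairs C" "E \<inter> pairs (S - C)" C "S - C"] that uC split
    by (auto simp: C)
  then show "C \<times> C \<subseteq> reach (E \<inter> pairs C)"
    by (rule reach_from_imp_connected)
  show "(a, b) \<in> reach (E \<inter> pairs (S - C))" if "a \<in> S - C" "(a, b) \<in> reach E" for a b
    using reach_Un_disjoint[of a b "E \<inter> pairs (S - C)" "E \<inter> pairs C" "S - C" C] that split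
    by (auto simp: Un_commute)
qed

lemma pairs_disjoint: "A \<inter> B = {} \<Longrightarrow> pairs A \<inter> pairs B = {}"
proof (rule equals0I)
  fix e assume "A \<inter> B = {}" "e \<in> pairs A \<inter> pairs B"
  then have "e = {}" "card e = 2" by (auto simp: pairs_def)
  then show False by simp
qed

lemma pairs_mono: "A \<subseteq> B \<Longrightarrow> pairs A \<subseteq> pairs B"
  by (auto simp: pairs_def)

lemma component_Un:
  assumes "E \<in> trees A" "F \<subseteq> pairs B" "A \<inter> B = {}" "u \<in> A"
  shows "reach (E \<union> F) `` {u} = A"
proof -
  have "(u, a) \<in> reach (E \<union> F)" if "a \<in> A" for a
    using assms that reach_mono[of E "E \<union> F" u a] by (auto simp: trees_def)
  moreover have "a \<in> A" if "(u, a) \<in> reach (E \<union> F)" for a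
    using reach_Un_disjoint[OF that] assms by (auto simp: trees_def forests_def)
  ultimately show ?thesis by auto
qed

lemma Un_Int_pairs:
  assumes "E \<subseteq> pairs A" "F \<subseteq> pairs B" "A \<inter> B = {}"
  shows "(E \<union> F) \<inter> pairs A = E" "(E \<union> F) \<inter> pairs B = F" "E \<inter> F = {}"
  using pairs_disjoint[OF assms(3)] assms by blast+

section \<open>Bijective decompositions of forests and trees\<close>

lemma finite_forests [simp]: "finite S \<Longrightarrow> finite (forests S)"
  by (rule finite_subset[of _ "Pow (pairs S)"]) (auto simp: forests_def)

lemma finite_trees [simp]: "finite S \<Longrightarrow> finite (trees S)"
  by (rule finite_subset[OF _ finite_forests]) (auto simp: trees_def)

lemma finite_forest: "finite S \<Longrightarrow> E \<in> forests S \<Longrightarrow> finite E"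
  using finite_subset[OF _ finite_pairs] by (auto simp: forests_def)

lemma treesD: "E \<in> trees S \<Longrightarrow> E \<in> forests S"
  by (simp add: trees_def)

text \<open>This bijection is behind the recursion for the weighted forest count. The inverse
  recovers \<open>A\<close> as the component of the marked vertex \<open>v\<close>.\<close>

lemma bij_forest_component:
  assumes v: "v \<in> S"
  shows "bij_betw (\<lambda>(A, E, F). E \<union> F)
    (SIGMA A:{A. v \<in> A \<and> A \<subseteq> S}. trees A \<times> forests (S - A)) (forests S)"
proof (rule bij_betw_byWitness[where f' = "\<lambda>E. let A = reach E `` {v} in (A, E \<inter> pairs A, E \<inter> pairs (S - A))"],
    goal_cases)
  case 1
  have *: "reach (E \<union> F) `` {v} = A" "(E \<union> F) \<inter> pairs A = E" "(E \<union> F) \<inter> pairs (S - A) = F"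
    if "v \<in> A" "E \<in> trees A" "F \<in> forests (S - A)" for A E F
    using component_Un[of E A F "S - A" v] Un_Int_pairs[of E A F "S - A"] that
    by (auto simp: forests_def trees_def)
  show ?case by (clarsimp simp: Let_def *)
next
  case 2
  then show ?case using component_split(3)[OF _ v] by (auto simp: forests_def Let_def)
next
  case 3
  have "E \<union> F \<in> forests S" if "A \<subseteq> S" "E \<in> trees A" "F \<in> forests (S - A)" for A E F
    using that forest_Un_disjoint[of E F A "S - A"] pairs_mono[of A S] pairs_mono[of "S - A" S]
    by (auto simp: forests_def trees_def)
  then show ?case by auto
next
  case 4
  have "v \<in> A \<and> A \<subseteq> S \<and> E \<inter> pairs A \<in> trees A \<and> E \<inter> pairs (S - A) \<in> forests (S - A)"
    if E: "E \<in> forests S" and A: "A = reach E `` {v}" for E A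
    using component_split[OF _ v A] forest_subset[of E] E
    by (auto simp: forests_def trees_def)
  then show ?case by (auto simp: Let_def)
qed

text \<open>Deleting an edge of a tree leaves two trees, and joining two trees by an edge gives a
  tree. The edge is oriented so that \<open>A\<close> can be singled out as the side of its tail
  \<open>u\<close>.\<close>

lemma bij_tree_edge:
  "bij_betw (\<lambda>(A, (E, F), u, v). (insert {u, v} (E \<union> F), u, v))
    (SIGMA A:Pow S. (trees A \<times> trees (S - A)) \<times> A \<times> (S - A))
    (SIGMA E:trees S. {(u, v). {u, v} \<in> E})"
proof (rule bij_betw_byWitness[where f' = "\<lambda>(E, u, v). let E' = E - {{u, v}}; A = reach E' `` {u} in
      (A, (E' \<inter> pairs A, E' \<inter> pairs (S - A)), u, v)"], goal_cases)
  case 1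
  have *: "E \<union> F - {{u, v}} = E \<union> F" "reach (E \<union> F) `` {u} = A"
      "(E \<union> F) \<inter> pairs A = E" "(E \<union> F) \<inter> pairs (S - A) = F"
    if "E \<in> trees A" "F \<in> trees (S - A)" "u \<in> A" "v \<in> S" "v \<notin> A" for A E F u v
  proof -
    have EF: "E \<subseteq> pairs A" "F \<subseteq> pairs (S - A)"
      using that by (auto simp: forests_def trees_def)
    then have "{u, v} \<notin> E \<union> F"
      using that edgeD[of u v E A] edgeD[of u v F "S - A"] by auto
    then show "E \<union> F - {{u, v}} = E \<union> F" "reach (E \<union> F) `` {u} = A"
      "(E \<union> F) \<inter> pairs A = E" "(E \<union> F) \<inter> pairs (S - A) = F"
      using component_Un[of E A F "S - A" u] Un_Int_pairs[of E A F "S - A"] that EF by auto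
  qed
  show ?case by (clarsimp simp: Let_def *)
next
  case 2
  have *: "insert {u, v} ((E - {{u, v}}) \<inter> pairs A \<union> (E - {{u, v}}) \<inter> pairs (S - A)) = E"
    if "E \<in> trees S" "{u, v} \<in> E" and A: "A = reach (E - {{u, v}}) `` {u}" for E u v A
  proof -
    have E: "E \<subseteq> pairs S" using that by (auto simp: forests_def trees_def)
    then have "E - {{u, v}} \<subseteq> pairs S" by auto
    from component_split(3)[OF this edgeD(1)[OF that(2) E] A] that(2)
    show ?thesis by blast
  qed
  show ?case by (clarsimp simp: Let_def *)
next
  case 3
  have "insert {u, v} (E \<union> F) \<in> trees S"
    if A: "A \<subseteq> S" and EF: "E \<in> trees A" "F \<in> trees (S - A)" and uv: "u \<in> A" "v \<in> S" "v \<notin> A"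
    for A E F u v
  proof -
    let ?G = "insert {u, v} (E \<union> F)"
    have sub: "E \<subseteq> pairs A" "F \<subseteq> pairs (S - A)" "forest E" "forest F"
      using EF by (auto simp: forests_def trees_def)
    have "(u, v) \<notin> reach (E \<union> F)"
      using reach_Un_disjoint[of u v E F A "S - A"] sub uv by auto
    then have "forest ?G"
      using forest_insert[OF forest_Un_disjoint[of E F A "S - A"]] sub by auto
    moreover have "?G \<subseteq> pairs S"
      using sub pairs_mono[of A S] pairs_mono[of "S - A" S] uv A by auto
    moreover have "S \<times> S \<subseteq> reach ?G"
    proof (rule reach_from_imp_connected)
      fix a assume a: "a \<in> S"
      show "(u, a) \<in> reach ?G"
      proof (cases "a \<in> A")
        case True
        then show ?thesis using EF uv reach_mono[of E ?G u a] by (auto simp: trees_def)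
      next
        case False
        then have "(v, a) \<in> reach ?G"
          using EF uv a reach_mono[of F ?G v a] by (auto simp: trees_def)
        then show ?thesis using reach_trans[OF reach_edge[of u v ?G]] by auto
      qed
    qed
    ultimately show ?thesis
      using uv by (auto simp: trees_def forests_def)
  qed
  then show ?case by auto
next
  case 4
  have *: "A \<subseteq> S \<and> E' \<inter> pairs A \<in> trees A \<and> E' \<inter> pairs (S - A) \<in> trees (S - A)
      \<and> u \<in> A \<and> v \<in> S - A"
    if E: "E \<in> trees S" "{u, v} \<in> E" and E': "E' = E - {{u, v}}" and A: "A = reach E' `` {u}"
    for E u v E' A
  proof -
    have E_sub: "E \<subseteq> pairs S" "forest E" and conn: "S \<times> S \<subseteq> reach E"
      using E by (auto simp: forests_def trees_def)
    have uv: "u \<in> S" "v \<in> S" "u \<noteq> v" using edgeD[OF E(2) E_sub(1)] by auto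
    have E'_sub: "E' \<subseteq> pairs S" "forest E'"
      using E_sub E' by (auto intro: forest_subset)
    note c = component_split[OF E'_sub(1) uv(1) A]
    have nuv: "(u, v) \<notin> reach E'" using E E_sub E' by (auto simp: forest_def)
    then have vA: "v \<in> S - A" using uv A by auto
    have "insert {u, v} E' = E" using E E' by auto
    have "(v, a) \<in> reach (E' \<inter> pairs (S - A))" if "a \<in> S - A" for a
    proof -
      have "(u, a) \<in> reach (insert {u, v} E')"
        using conn uv that \<open>insert {u, v} E' = E\<close> by auto
      then have "(v, a) \<in> reach E'"
        using reach_insert[of u a u v E'] nuv that A by auto
      then show ?thesis using c(5) vA by auto
    qed
    then have "(S - A) \<times> (S - A) \<subseteq> reach (E' \<inter> pairs (S - A))"
      by (rule reach_from_imp_connected)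
    then show ?thesis
      using c vA forest_subset[OF E'_sub(2)] by (auto simp: trees_def forests_def)
  qed
  show ?case by (rule image_subsetI) (clarsimp simp: Let_def *[OF _ _ refl refl], insert *[OF _ _ refl refl], auto)
qed

section \<open>Cayley's formula\<close>

lemma card_arcs:
  assumes "finite E" "E \<subseteq> pairs S"
  shows "finite {(u, v). {u, v} \<in> E} \<and> card {(u, v). {u, v} \<in> E} = 2 * card E"
  using assms
proof (induction E rule: finite_induct)
  case (insert e E)
  then have "e \<in> pairs S" by simp
  then obtain a b where ab: "e = {a, b}" "a \<noteq> b"
    by (auto simp: pairs_def card_2_iff)
  have "{(u, v). {u, v} \<in> insert e E} = {(a, b), (b, a)} \<union> {(u, v). {u, v} \<in> E}"
    by (auto simp: ab doubleton_eq_iff)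
  moreover have "{(a, b), (b, a)} \<inter> {(u, v). {u, v} \<in> E} = {}"
    using insert.hyps ab by (auto simp: insert_commute[of b a "{}"])
  moreover have "card {(a, b), (b, a)} = 2" using ab by simp
  ultimately show ?case
    using insert ab by (simp add: card_insert_if)
qed simp

text \<open>Strong induction on the number of vertices: any edge splits the tree into two smaller
  ones by \<open>bij_tree_edge\<close>.\<close>

lemma card_tree:
  assumes "finite S" "E \<in> trees S"
  shows "Suc (card E) = card S"
  using assms
proof (induction "card S" arbitrary: S E rule: less_induct)
  case less
  note fin = finite_forest[OF less.prems(1) treesD[OF less.prems(2)]]
  show ?case
  proof (cases "E = {}")
    case True
    have "reach {} = Id" by (simp add: reach_def)
    then have "S \<times> S \<subseteq> Id" "S \<noteq> {}"
      using less.prems True by (auto simp: trees_def)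
    then obtain a where "S = {a}" by blast
    then show ?thesis using True by simp
  next
    case False
    then obtain e where "e \<in> E" by auto
    moreover have "E \<subseteq> pairs S" using less.prems by (auto simp: trees_def forests_def)
    ultimately obtain u v where uv: "{u, v} \<in> E"
      by (auto simp: pairs_def card_2_iff dest!: subsetD)
    then have "(E, u, v) \<in> (\<lambda>(A, (E, F), u, v). (insert {u, v} (E \<union> F), u, v)) `
        (SIGMA A:Pow S. (trees A \<times> trees (S - A)) \<times> A \<times> (S - A))"
      using less.prems unfolding bij_betw_imp_surj_on[OF bij_tree_edge] by auto
    then obtain A E1 E2 where A: "A \<subseteq> S" "E1 \<in> trees A" "E2 \<in> trees (S - A)" "u \<in> A" "v \<in> S - A"
      and E: "E = insert {u, v} (E1 \<union> E2)"
      by auto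
    have fA: "finite A" "finite (S - A)" using A less.prems finite_subset by auto
    have fE: "finite E1" "finite E2" using fin E by auto
    have sub: "E1 \<subseteq> pairs A" "E2 \<subseteq> pairs (S - A)"
      using A by (auto simp: trees_def forests_def)
    then have "{u, v} \<notin> E1 \<union> E2"
      using A edgeD[of u v E1 A] edgeD[of u v E2 "S - A"] by auto
    then have "card E = Suc (card E1 + card E2)"
      using E fE Un_Int_pairs(3)[OF sub] by (simp add: card_Un_disjoint)
    moreover have "A \<subset> S" "S - A \<subset> S" using A by auto
    then have "card A < card S" "card (S - A) < card S"
      using less.prems psubset_card_mono by auto
    then have "Suc (card E1) = card A" "Suc (card E2) = card (S - A)"
      using less.hyps fA A by auto
    moreover have "card S = card A + card (S - A)"
      using A less.prems fA by (simp add: card_Diff_subset card_mono)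
    ultimately show ?thesis by simp
  qed
qed

lemma trees_empty [simp]: "trees {} = {}"
  by (simp add: trees_def)

text \<open>Double counting along \<open>bij_tree_edge\<close>: a tree on \<open>S\<close> has
  \<open>card S - 1\<close> edges, each with two orientations.\<close>

lemma tree_edge_recursion:
  assumes "finite S"
  shows "(\<Sum>A\<in>Pow S. card A * card (trees A) * (card (S - A) * card (trees (S - A))))
    = 2 * (card S - 1) * card (trees S)"
proof -
  have fin: "finite A" if "A \<in> Pow S" for A using that assms finite_subset by auto
  have "card (SIGMA A:Pow S. (trees A \<times> trees (S - A)) \<times> A \<times> (S - A))
      = (\<Sum>A\<in>Pow S. card A * card (trees A) * (card (S - A) * card (trees (S - A))))"
    using assms fin by (subst card_SigmaI) (auto simp: card_cartesian_product mult_ac)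
  moreover have "card (SIGMA E:trees S. {(u, v). {u, v} \<in> E}) = (\<Sum>E\<in>trees S. 2 * (card S - 1))"
  proof (subst card_SigmaI)
    have *: "finite {(u, v). {u, v} \<in> E} \<and> card {(u, v). {u, v} \<in> E} = 2 * (card S - 1)"
      if "E \<in> trees S" for E
      using card_arcs[of E S] card_tree[OF assms that] finite_forest[OF assms treesD[OF that]] that
      by (auto simp: trees_def forests_def)
    show "\<forall>E\<in>trees S. finite {(u, v). {u, v} \<in> E}"
      "(\<Sum>E\<in>trees S. card {(u, v). {u, v} \<in> E}) = (\<Sum>E\<in>trees S. 2 * (card S - 1))"
      using * by auto
  qed (use assms in auto)
  ultimately show ?thesis
    using bij_betw_same_card[OF bij_tree_edge[of S]] by (simp add: mult_ac)
qed

section \<open>Finite differences and Abel's binomial identity\<close>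

lemma sum_alternating_choose_Suc:
  fixes h :: "nat \<Rightarrow> real"
  shows "(\<Sum>k\<le>Suc n. (-1) ^ k * real (Suc n choose k) * h k)
    = (\<Sum>k\<le>n. (-1) ^ k * real (n choose k) * (h k - h (Suc k)))"
proof -
  have "(\<Sum>k\<le>n. (-1) ^ k * real (n choose k) * h k) = (\<Sum>k\<le>Suc n. (-1) ^ k * real (n choose k) * h k)"
    by simp
  also have "\<dots> = h 0 + (\<Sum>k\<le>n. (-1) ^ Suc k * real (n choose Suc k) * h (Suc k))"
    by (subst sum.atMost_Suc_shift) simp
  finally have *: "(\<Sum>k\<le>n. (-1) ^ k * real (n choose k) * h k)
    = h 0 + (\<Sum>k\<le>n. (-1) ^ Suc k * real (n choose Suc k) * h (Suc k))" .
  show ?thesis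
    unfolding right_diff_distrib sum_subtractf *
    by (subst sum.atMost_Suc_shift) (simp add: algebra_simps sum.distrib sum_negf sum_subtractf)
qed

lemma constant_of_DERIV_0:
  fixes f :: "real \<Rightarrow> real"
  assumes "\<And>x. (f has_real_derivative 0) (at x)" shows "f x = f y"
  using DERIV_isconst_all[of f x y] assms by auto

lemma DERIV_shifted_power:
  fixes c x :: real
  shows "((\<lambda>x. (x + c) ^ m) has_real_derivative real m * (x + c) ^ (m - 1)) (at x)"
  by (auto intro!: derivative_eq_intros)

text \<open>Differences of order \<open>n\<close> annihilate polynomials of lower degree. The
  difference of order \<open>m\<close> of the power \<open>Suc j\<close> has as derivative a
  multiple of the one of the power \<open>j\<close>, which is zero by induction; so it is constant,
  and one further difference kills it.\<close>

lemma finite_difference_power: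
  fixes x :: real
  assumes "j < n"
  shows "(\<Sum>k\<le>n. (-1) ^ k * real (n choose k) * (x + k) ^ j) = 0"
  using assms
proof (induction j arbitrary: n x)
  case 0
  then show ?case using choose_alternating_sum[of n, where 'a = real] by simp
next
  case (Suc j)
  then obtain m where n: "n = Suc m" "j < m" by (cases n) auto
  define g where "g x = (\<Sum>k\<le>m. (-1) ^ k * real (m choose k) * (x + k) ^ Suc j)" for x :: real
  have "(g has_real_derivative real (Suc j) * (\<Sum>k\<le>m. (-1) ^ k * real (m choose k) * (x + k) ^ j)) (at x)"
    for x :: real
  proof -
    have "(g has_real_derivative (\<Sum>k\<le>m. (-1) ^ k * real (m choose k) *
        (real (Suc j) * (x + k) ^ (Suc j - 1)))) (at x)"
      unfolding g_def by (intro DERIV_sum DERIV_cmult DERIV_shifted_power)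
    then show ?thesis by (simp add: sum_distrib_left mult_ac)
  qed
  then have "(g has_real_derivative 0) (at x)" for x
    using Suc.IH[OF n(2), of x] by (metis mult_zero_right)
  then have "g x = g (x + 1)" by (rule constant_of_DERIV_0)
  then show ?case
    unfolding n sum_alternating_choose_Suc
    by (simp add: g_def right_diff_distrib sum_subtractf algebra_simps)
qed

text \<open>Both sides have the same derivative in \<open>y\<close>, and they agree at
  \<open>y = - x - n\<close>, where the left-hand side is a finite difference.\<close>

lemma abel_binomial:
  fixes x y :: real
  shows "(\<Sum>k\<le>n. (n choose k) * (if k = 0 then 1 else x * (x + k) ^ (k - 1)) * (y + real (n - k)) ^ (n - k))
    = (x + y + n) ^ n"
proof (induction n arbitrary: y)
  case (Suc n)
  \<comment> \<open>At \<open>k = 0\<close> the intended factor is x times the inverse of x, that is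
    1; truncated subtraction would give \<open>x\<close> instead.\<close>
  define b where "b k = (if k = 0 then 1 else x * (x + real k) ^ (k - 1))" for k :: nat
  define g where "g y = (\<Sum>k\<le>Suc n. (Suc n choose k) * b k * (y + real (Suc n - k)) ^ (Suc n - k))
    - (x + y + Suc n) ^ Suc n" for y
  have "(g has_real_derivative 0) (at y)" for y
  proof -
    have "(g has_real_derivative (\<Sum>k\<le>Suc n. (Suc n choose k) * b k *
        (real (Suc n - k) * (y + real (Suc n - k)) ^ (Suc n - k - 1))) - Suc n * (x + y + Suc n) ^ n) (at y)"
      using DERIV_shifted_power[of "x + Suc n" "Suc n" y]
      unfolding g_def by (intro DERIV_diff DERIV_sum DERIV_cmult DERIV_shifted_power) (simp add: ac_simps)
    \<comment> \<open>Absorption of the factor \<open>Suc n - k\<close> into the binomial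
      coefficient turns the derivative into \<open>Suc n\<close> times the identity for
      \<open>n\<close> at \<open>y + 1\<close>, so the induction hypothesis applies.\<close>
    moreover have "(\<Sum>k\<le>Suc n. (Suc n choose k) * b k *
        (real (Suc n - k) * (y + real (Suc n - k)) ^ (Suc n - k - 1)))
      = Suc n * (\<Sum>k\<le>n. (n choose k) * b k * ((y + 1) + real (n - k)) ^ (n - k))"
    proof -
      have "(Suc n choose k) * b k * (real (Suc n - k) * (y + real (Suc n - k)) ^ (Suc n - k - 1))
        = Suc n * ((n choose k) * b k * ((y + 1) + real (n - k)) ^ (n - k))" if "k \<le> n" for k
      proof -
        have "(Suc n choose k) * (Suc n - k) = Suc n * (n choose k)"
          using binomial_absorb_comp[of "Suc n" k] by (simp add: mult.commute)
        then have "real (Suc n choose k) * real (Suc n - k) = real (Suc n) * real (n choose k)"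
          by (metis of_nat_mult)
        note absorb = this
        have e: "y + real (Suc n - k) = (y + 1) + real (n - k)" "Suc n - k - 1 = n - k"
          using that by (auto simp: of_nat_diff)
        have "(Suc n choose k) * b k * (real (Suc n - k) * P) = Suc n * ((n choose k) * b k * P)" for P
          using arg_cong[OF absorb, of "\<lambda>t. t * (b k * P)"] by (simp only: mult_ac)
        then show ?thesis unfolding e .
      qed
      note term_eq = this
      have "(\<Sum>k\<le>Suc n. (Suc n choose k) * b k * (real (Suc n - k) * (y + real (Suc n - k)) ^ (Suc n - k - 1)))
        = (\<Sum>k\<le>n. (Suc n choose k) * b k * (real (Suc n - k) * (y + real (Suc n - k)) ^ (Suc n - k - 1)))"
        by simp
      also have "\<dots> = (\<Sum>k\<le>n. Suc n * ((n choose k) * b k * ((y + 1) + real (n - k)) ^ (n - k)))"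
        by (intro sum.cong refl term_eq) simp
      finally show ?thesis unfolding sum_distrib_left .
    qed
    ultimately show ?thesis
      using Suc.IH[of "y + 1"] by (simp add: b_def algebra_simps)
  qed
  then have "g y = g (- x - Suc n)" by (rule constant_of_DERIV_0)
  also have "\<dots> = (\<Sum>k\<le>Suc n. (-1) ^ Suc n * x * ((-1) ^ k * real (Suc n choose k) * (x + k) ^ n))"
  proof -
    have "b k * (- x - Suc n + real (Suc n - k)) ^ (Suc n - k) = (-1) ^ Suc n * (-1) ^ k * x * (x + k) ^ n"
      if "k \<le> Suc n" for k
    proof -
      have "- x - Suc n + real (Suc n - k) = - (x + k)" using that by (auto simp: of_nat_diff)
      moreover have "b k * (x + k) ^ (Suc n - k) = x * (x + k) ^ n"
      proof (cases k)
        case (Suc j)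
        then have "(x + k) ^ j * (x + k) ^ (Suc n - k) = (x + k) ^ n"
          using that by (simp flip: power_add)
        then show ?thesis using Suc by (simp add: b_def mult_ac)
      qed (simp add: b_def)
      moreover have "(-1 :: real) ^ (Suc n - k) = (-1) ^ Suc n * (-1) ^ k"
        using that by (metis (no_types, lifting) le_add_diff_inverse2 minus_one_mult_self
            mult.assoc mult.right_neutral power_add)
      ultimately show ?thesis by (metis (no_types) mult.assoc mult.left_commute power_minus)
    qed
    note term_eq = this
    have "(\<Sum>k\<le>Suc n. (Suc n choose k) * b k * (- x - Suc n + real (Suc n - k)) ^ (Suc n - k))
      = (\<Sum>k\<le>Suc n. (-1) ^ Suc n * x * ((-1) ^ k * real (Suc n choose k) * (x + k) ^ n))"
    proof (rule sum.cong[OF refl])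
      fix k assume "k \<in> {..Suc n}"
      then show "(Suc n choose k) * b k * (- x - Suc n + real (Suc n - k)) ^ (Suc n - k)
        = (-1) ^ Suc n * x * ((-1) ^ k * real (Suc n choose k) * (x + k) ^ n)"
        using arg_cong[OF term_eq[of k], of "\<lambda>t. (Suc n choose k) * t"] by (simp only: atMost_iff mult_ac)
    qed
    moreover have "x + (- x - real (Suc n)) + real (Suc n) = 0" by simp
    ultimately show ?thesis unfolding g_def by simp
  qed
  also have "\<dots> = 0"
    using finite_difference_power[of n "Suc n" x] by (simp only: sum_distrib_left[symmetric])
  finally show ?case by (simp add: g_def b_def)
qed simp

text \<open>\<open>r k\<close> counts rooted labelled trees, with \<open>r 0 = 0\<close> and
  \<open>r 1 = 1\<close> under truncated subtraction. Differentiating Abel's identity with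
  \<open>y = 0\<close> at \<open>x = 0\<close> produces the convolution weighted by
  \<open>n - k\<close>; adding its reflection weighted by \<open>k\<close> replaces the weight by
  \<open>n\<close>.\<close>

lemma abel_convolution:
  fixes r :: "nat \<Rightarrow> real"
  defines "r \<equiv> \<lambda>k. real k * real k ^ (k - 2)"
  assumes n: "n > 0"
  shows "(\<Sum>k\<le>n. (n choose k) * (r k * r (n - k))) = 2 * (real n - 1) * real n ^ (n - 2)"
proof -
  have r: "r k = real k ^ (k - 1)" if "k > 0" for k
    using that by (cases "k = 1") (auto simp: r_def simp flip: power_Suc)
  define b where "b k x = (if k = 0 then 1 else x * (x + real k) ^ (k - 1))" for k and x :: real
  have b': "(b k has_real_derivative r k) (at 0)" for k
  proof (cases "k = 0")
    case True
    then show ?thesis by (simp add: b_def[abs_def] r_def)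
  next
    case False
    have "((\<lambda>x. x * (x + real k) ^ (k - 1)) has_real_derivative
        1 * (0 + real k) ^ (k - 1) + (real (k - 1) * (0 + real k) ^ (k - 1 - 1)) * 0) (at 0)"
      by (intro DERIV_mult DERIV_ident DERIV_shifted_power)
    then show ?thesis using False by (simp add: b_def[abs_def] r)
  qed
  have "((\<lambda>x. \<Sum>k\<le>n. ((n choose k) * real (n - k) ^ (n - k)) * b k x) has_real_derivative
      (\<Sum>k\<le>n. ((n choose k) * real (n - k) ^ (n - k)) * r k)) (at 0)"
    by (intro DERIV_sum DERIV_cmult b')
  moreover have "(\<lambda>x. \<Sum>k\<le>n. ((n choose k) * real (n - k) ^ (n - k)) * b k x) = (\<lambda>x. (x + real n) ^ n)"
    using abel_binomial[of n _ 0] by (simp add: b_def mult_ac)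
  moreover have "((\<lambda>x. (x + real n) ^ n) has_real_derivative real n * (0 + real n) ^ (n - 1)) (at 0)"
    by (rule DERIV_shifted_power)
  ultimately have 1: "(\<Sum>k\<le>n. ((n choose k) * real (n - k) ^ (n - k)) * r k) = real n * real n ^ (n - 1)"
    using DERIV_unique by fastforce
  define S where "S = (\<Sum>k\<le>n. (n choose k) * (r k * r (n - k)))"
  \<comment> \<open>The term \<open>k = n\<close> is exceptional: \<open>0 ^ 0 = 1\<close> on the
    left, while the weight \<open>n - k\<close> on the right is zero.\<close>
  have "((n choose k) * real (n - k) ^ (n - k)) * r k
      = (n choose k) * (r k * r (n - k)) * real (n - k) + (if k = n then r n else 0)" if "k \<le> n" for k
  proof (cases "k = n")
    case False
    then have "real (n - k) ^ (n - k) = r (n - k) * real (n - k)"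
      using that power_minus_mult[of "n - k" "real (n - k)"] by (simp add: r del: of_nat_diff)
    then show ?thesis using False by simp
  qed simp
  then have "(\<Sum>k\<le>n. ((n choose k) * real (n - k) ^ (n - k)) * r k)
      = (\<Sum>k\<le>n. (n choose k) * (r k * r (n - k)) * real (n - k)) + r n"
    by (simp add: sum.distrib)
  with 1 have 2: "(\<Sum>k\<le>n. (n choose k) * (r k * r (n - k)) * real (n - k)) = (real n - 1) * real n ^ (n - 1)"
    using n by (simp add: r algebra_simps)
  have "(\<Sum>k\<le>n. (n choose k) * (r k * r (n - k)) * real (n - k))
      = (\<Sum>k\<le>n. (n choose k) * (r k * r (n - k)) * real k)"
    by (rule sum.reindex_bij_witness[of _ "\<lambda>k. n - k" "\<lambda>k. n - k"])
      (auto simp: binomial_symmetric[symmetric])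
  then have "2 * ((real n - 1) * real n ^ (n - 1))
      = (\<Sum>k\<le>n. (n choose k) * (r k * r (n - k)) * real (n - k))
      + (\<Sum>k\<le>n. (n choose k) * (r k * r (n - k)) * real k)"
    using 2 by simp
  also have "\<dots> = (\<Sum>k\<le>n. real n * ((n choose k) * (r k * r (n - k))))"
    unfolding sum.distrib[symmetric]
    by (rule sum.cong) (auto simp: of_nat_diff algebra_simps)
  also have "\<dots> = real n * S" by (simp add: S_def sum_distrib_left)
  finally have 3: "2 * ((real n - 1) * real n ^ (n - 1)) = real n * S" .
  show ?thesis
  proof (cases "n = 1")
    case False
    then have "real n ^ (n - 1) = real n * real n ^ (n - 2)"
      using n by (simp flip: power_Suc add: Suc_diff_Suc numeral_2_eq_2)
    with 3 have "real n * S = real n * (2 * (real n - 1) * real n ^ (n - 2))"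
      by (simp only: mult_ac)
    with n show ?thesis by (simp add: S_def)
  qed (use 3 in \<open>simp add: S_def\<close>)
qed

lemma sum_Pow_card:
  fixes f :: "nat \<Rightarrow> 'b::comm_semiring_1"
  assumes "finite S"
  shows "(\<Sum>A\<in>Pow S. f (card A)) = (\<Sum>k\<le>card S. of_nat (card S choose k) * f k)"
proof -
  have "(\<Sum>A\<in>Pow S. f (card A)) = (\<Sum>k\<le>card S. \<Sum>A | A \<in> Pow S \<and> card A = k. f (card A))"
    using assms by (intro sum.group[symmetric]) (auto intro: card_mono)
  also have "\<dots> = (\<Sum>k\<le>card S. of_nat (card {A. A \<subseteq> S \<and> card A = k}) * f k)"
    by (intro sum.cong) auto
  finally show ?thesis using assms by (simp add: n_subsets)
qed

text \<open>Strong induction: \<open>tree_edge_recursion\<close> and \<open>abel_convolution\<close>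
  show that the two sides obey the same recursion. Its factor \<open>2 * (n - 1)\<close> can be
  cancelled only for \<open>n > 1\<close>, so a single vertex is treated separately.\<close>

theorem cayley:
  assumes "finite S" "S \<noteq> {}"
  shows "card (trees S) = card S ^ (card S - 2)"
  using assms
proof (induction "card S" arbitrary: S rule: less_induct)
  case less
  define n where "n = card S"
  define r where "r k = real k * real k ^ (k - 2)" for k :: nat
  have n: "n > 0" using less.prems by (simp add: n_def card_gt_0_iff)
  show ?case
  proof (cases "n = 1")
    case True
    then obtain a where S: "S = {a}" by (auto simp: n_def card_1_singleton_iff)
    have "pairs {a} = {}"
      by (auto simp: pairs_def card_2_iff doubleton_eq_iff subset_singleton_iff)
    then have "trees {a} = {{}}" by (auto simp: trees_def forests_def forest_def)
    then show ?thesis by (simp add: S)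
  next
    case False
    have *: "real (card A * card (trees A)) = r (card A)" if "A \<subset> S" for A
    proof (cases "A = {}")
      case False
      then show ?thesis
        using less.hyps[of A] psubset_card_mono[OF less.prems(1) that] that
          finite_subset[of A S] less.prems by (auto simp: r_def)
    qed (simp add: r_def)
    \<comment> \<open>For \<open>A = {}\<close> and \<open>A = S\<close> both sides are zero, so the
      induction hypothesis is used for proper subsets only.\<close>
    have "real (card A * card (trees A) * (card (S - A) * card (trees (S - A)))) = r (card A) * r (n - card A)"
      if "A \<in> Pow S" for A
    proof (cases "A = {} \<or> A = S")
      case False
      then have "A \<subset> S" "S - A \<subset> S" using that by auto
      then show ?thesis
        using *[of A] *[of "S - A"] less.prems finite_subset[of A S]
        by (simp add: n_def card_Diff_subset psubset_imp_subset)
    qed (auto simp: r_def n_def)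
    then have "real (2 * (n - 1) * card (trees S)) = (\<Sum>A\<in>Pow S. r (card A) * r (n - card A))"
      unfolding n_def tree_edge_recursion[OF less.prems(1), symmetric] of_nat_sum by (intro sum.cong) (auto simp: n_def)
    also have "\<dots> = (\<Sum>k\<le>n. (n choose k) * (r k * r (n - k)))"
      using sum_Pow_card[OF less.prems(1), of "\<lambda>k. r k * r (n - k)"] by (simp add: n_def)
    also have "\<dots> = 2 * (real n - 1) * real n ^ (n - 2)"
      unfolding r_def by (rule abel_convolution[OF n])
    finally have "real (card (trees S)) = real (n ^ (n - 2))"
      using n False by (simp add: of_nat_diff)
    then show ?thesis unfolding n_def of_nat_eq_iff .
  qed
qed

section \<open>The weighted count of forests\<close>

text \<open>Zero is singled out because \<open>0 ^ (0 - 2)\<close> evaluates to 1; for one vertex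
  the truncated exponent gives the correct value 1.\<close>

definition tree_count :: "nat \<Rightarrow> real" where
  "tree_count n = (if n = 0 then 0 else real n ^ (n - 2))"

text \<open>This is \<open>Z\<^sub>n(q)\<close> on an arbitrary vertex set of size \<open>n\<close>,
  since removing a component leaves an arbitrary subset.\<close>

definition forest_weight :: "real \<Rightarrow> 'a set \<Rightarrow> real" where
  "forest_weight q S = (\<Sum>E\<in>forests S. q ^ card E)"

definition forest_poly :: "real \<Rightarrow> nat \<Rightarrow> real" where
  "forest_poly q n = forest_weight q {1..n}"

lemma card_trees: "finite S \<Longrightarrow> real (card (trees S)) = tree_count (card S)"
  by (cases "S = {}") (simp_all add: tree_count_def cayley)

lemma tree_count_nonneg [simp]: "tree_count n \<ge> 0"
  by (simp add: tree_count_def)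

lemma forest_weight_component:
  assumes S: "finite S" and v: "v \<in> S"
  shows "forest_weight q S
    = (\<Sum>A | v \<in> A \<and> A \<subseteq> S. tree_count (card A) * q ^ (card A - 1) * forest_weight q (S - A))"
proof -
  have fin: "finite A" if "A \<subseteq> S" for A using that S finite_subset by auto
  have fin_index: "finite {A. v \<in> A \<and> A \<subseteq> S}"
    by (rule finite_subset[of _ "Pow S"]) (use S in auto)
  have "forest_weight q S = (\<Sum>(A, E, F)\<in>(SIGMA A:{A. v \<in> A \<and> A \<subseteq> S}. trees A \<times> forests (S - A)).
      q ^ card (E \<union> F))"
    unfolding forest_weight_def sum.reindex_bij_betw[OF bij_forest_component[OF v], symmetric]
    by (simp add: case_prod_unfold)
  also have "\<dots> = (\<Sum>A | v \<in> A \<and> A \<subseteq> S. \<Sum>(E, F)\<in>trees A \<times> forests (S - A). q ^ card (E \<union> F))"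
    using fin_index fin S by (subst sum.Sigma) auto
  also have "\<dots> = (\<Sum>A | v \<in> A \<and> A \<subseteq> S. \<Sum>E\<in>trees A. \<Sum>F\<in>forests (S - A). q ^ (card A - 1) * q ^ card F)"
  proof (rule sum.cong[OF refl])
    fix A assume "A \<in> {A. v \<in> A \<and> A \<subseteq> S}"
    then have A: "A \<subseteq> S" "finite A" using fin by auto
    have "q ^ card (E \<union> F) = q ^ (card A - 1) * q ^ card F"
      if E: "E \<in> trees A" and F: "F \<in> forests (S - A)" for E F
    proof -
      have "E \<inter> F = {}"
        using Un_Int_pairs(3)[of E A F "S - A"] E F by (auto simp: trees_def forests_def)
      moreover have "finite E" "finite F"
        using finite_forest[OF A(2) treesD[OF E]] finite_forest[OF _ F] S by auto
      ultimately show ?thesis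
        using card_tree[OF A(2) E] by (simp add: card_Un_disjoint power_add flip: card_tree[OF A(2) E])
    qed
    then show "(\<Sum>(E, F)\<in>trees A \<times> forests (S - A). q ^ card (E \<union> F))
      = (\<Sum>E\<in>trees A. \<Sum>F\<in>forests (S - A). q ^ (card A - 1) * q ^ card F)"
      by (simp add: sum.cartesian_product[symmetric])
  qed
  also have "\<dots> = (\<Sum>A | v \<in> A \<and> A \<subseteq> S. tree_count (card A) * q ^ (card A - 1) * forest_weight q (S - A))"
    using fin by (auto intro!: sum.cong simp: forest_weight_def card_trees sum_distrib_left mult_ac)
  finally show ?thesis .
qed

lemma sum_supersets_card:
  fixes f :: "nat \<Rightarrow> real"
  assumes "finite S" "v \<in> S"
  shows "(\<Sum>A | v \<in> A \<and> A \<subseteq> S. f (card A)) = (\<Sum>k\<le>card S - 1. (card S - 1 choose k) * f (Suc k))"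
proof -
  have "(\<Sum>A | v \<in> A \<and> A \<subseteq> S. f (card A)) = (\<Sum>B\<in>Pow (S - {v}). f (Suc (card B)))"
  proof (rule sum.reindex_bij_witness[of _ "insert v" "\<lambda>A. A - {v}"], goal_cases)
    case (5 A)
    then show ?case using assms finite_subset[of A S] card_Suc_Diff1[of A v] by auto
  qed (use assms in auto)
  also have "\<dots> = (\<Sum>k\<le>card (S - {v}). real (card (S - {v}) choose k) * f (Suc k))"
    using assms by (subst sum_Pow_card[where f = "\<lambda>k. f (Suc k)"]) auto
  finally show ?thesis using assms by simp
qed

lemma forests_empty: "forests {} = {{}}"
  by (auto simp: forests_def pairs_def forest_def)

text \<open>Independence of the actual vertex set is assumed for smaller sets only. Thus the same
  statement serves both to prove that independence by induction and to derive the final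
  recursion.\<close>

lemma forest_weight_Suc:
  fixes S :: "nat set"
  assumes S: "finite S" "card S = Suc n"
    and smaller: "\<And>T :: nat set. finite T \<Longrightarrow> card T \<le> n \<Longrightarrow> forest_weight q T = forest_poly q (card T)"
  shows "forest_weight q S = (\<Sum>k\<le>n. (n choose k) * tree_count (Suc k) * q ^ k * forest_poly q (n - k))"
proof -
  obtain v where v: "v \<in> S" using S by (auto simp: card_Suc_eq)
  define f where "f k = tree_count k * q ^ (k - 1) * forest_poly q (Suc n - k)" for k
  have "forest_weight q S = (\<Sum>A | v \<in> A \<and> A \<subseteq> S. f (card A))"
    unfolding forest_weight_component[OF S(1) v] f_def
  proof (intro sum.cong refl arg_cong2[where f = "(*)"])
    fix A assume A: "A \<in> {A. v \<in> A \<and> A \<subseteq> S}"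
    then have "finite A" "card A > 0" using S finite_subset[of A S] by (auto simp: card_gt_0_iff)
    then show "forest_weight q (S - A) = forest_poly q (Suc n - card A)"
      using smaller[of "S - A"] A S by (simp add: card_Diff_subset)
  qed
  also have "\<dots> = (\<Sum>k\<le>n. (n choose k) * f (Suc k))"
    using sum_supersets_card[OF S(1) v, of f] S(2) by simp
  finally show ?thesis by (simp add: f_def mult_ac)
qed

text \<open>\<open>S\<close> and \<open>{1..Suc n}\<close> satisfy the same recursion in terms of
  smaller sizes; this takes the place of a relabelling bijection.\<close>

lemma forest_weight_conv_poly:
  fixes S :: "nat set"
  assumes "finite S"
  shows "forest_weight q S = forest_poly q (card S)"
  using assms
proof (induction "card S" arbitrary: S rule: less_induct)
  case less
  show ?case
  proof (cases "card S")
    case 0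
    then show ?thesis using less.prems by (simp add: forest_poly_def)
  next
    case (Suc n)
    have smaller: "forest_weight q T = forest_poly q (card T)" if "finite T" "card T \<le> n" for T :: "nat set"
      using less.hyps[of T] that Suc by simp
    have "forest_weight q S = forest_weight q {1..Suc n}"
      using forest_weight_Suc[OF less.prems Suc smaller] forest_weight_Suc[of "{1..Suc n}" n q] smaller
      by simp
    then show ?thesis by (simp add: Suc forest_poly_def)
  qed
qed

lemma forest_poly_0 [simp]: "forest_poly q 0 = 1"
  by (simp add: forest_poly_def forest_weight_def forests_empty)

lemma forest_poly_Suc:
  "forest_poly q (Suc n) = (\<Sum>k\<le>n. (n choose k) * tree_count (Suc k) * q ^ k * forest_poly q (n - k))"
  unfolding forest_poly_def[of q "Suc n"]
  by (rule forest_weight_Suc) (auto intro: forest_weight_conv_poly)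

lemma forest_poly_nonneg: "q \<ge> 0 \<Longrightarrow> forest_poly q n \<ge> 0"
  by (auto simp: forest_poly_def forest_weight_def intro!: sum_nonneg)

section \<open>Generating functions and the upper bound for the forest count\<close>

lemma power_div_fact_le_exp:
  fixes x :: real
  assumes "x \<ge> 0" shows "x ^ n / fact n \<le> exp x"
proof -
  have "(\<Sum>k\<in>{n}. inverse (fact k) * x ^ k) \<le> (\<Sum>k. inverse (fact k) * x ^ k)"
    using summable_exp[of x] assms by (intro sum_le_suminf) auto
  then show ?thesis by (simp add: exp_def field_simps)
qed

text \<open>A crude Stirling bound: the excess \<open>exp 1 * n\<close> over
  \<open>(n / e) ^ n\<close> disappears in the \<open>n\<close>-th root. The induction step is
  \<open>(m / (m + 1)) ^ (m + 1) \<le> exp (- 1)\<close>.\<close>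

lemma fact_le_power_exp:
  assumes "n > 0" shows "fact n \<le> real n ^ Suc n * exp (1 - real n)"
  using assms
proof (induction n)
  case (Suc n)
  show ?case
  proof (cases "n = 0")
    case False
    define m where "m = real n"
    have m: "m > 0" using False by (simp add: m_def)
    have "(m / (m + 1)) ^ Suc n \<le> exp (- 1 / (m + 1)) ^ Suc n"
    proof (rule power_mono)
      have "m / (m + 1) = 1 + (- 1 / (m + 1))" using m by (simp add: field_simps)
      also have "\<dots> \<le> exp (- 1 / (m + 1))" by (rule exp_ge_add_one_self)
      finally show "m / (m + 1) \<le> exp (- 1 / (m + 1))" .
    qed (use m in auto)
    also have "\<dots> = exp (real (Suc n) * (- 1 / (m + 1)))" by (rule exp_of_nat_mult[symmetric])
    also have "real (Suc n) * (- 1 / (m + 1)) = - 1" using m by (simp add: m_def)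
    finally have "m ^ Suc n \<le> exp (- 1) * (m + 1) ^ Suc n"
      using m by (simp add: power_divide pos_divide_le_eq)
    then have "(m + 1) * (m ^ Suc n * exp (1 - m)) \<le> (m + 1) * (exp (- 1) * (m + 1) ^ Suc n * exp (1 - m))"
      using m by (intro mult_left_mono mult_right_mono) auto
    also have "\<dots> = (m + 1) ^ Suc (Suc n) * (exp (- 1) * exp (1 - m))" by simp
    also have "exp (- 1) * exp (1 - m) = exp (- m)" by (simp flip: exp_add)
    finally have *: "(m + 1) * (m ^ Suc n * exp (1 - m)) \<le> (m + 1) ^ Suc (Suc n) * exp (- m)" .
    have "fact (Suc n) = (m + 1) * fact n" by (simp add: m_def)
    also have "\<dots> \<le> (m + 1) * (m ^ Suc n * exp (1 - m))"
      using Suc.IH False m by (intro mult_left_mono) (auto simp: m_def)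
    also note *
    finally show ?thesis by (simp add: m_def add.commute)
  qed simp
qed simp

text \<open>Since \<open>n ^ n / fact n \<le> exp n\<close>, both series are dominated by the
  geometric series of ratio \<open>exp 1 * x\<close>.\<close>

lemma tree_series_summable:
  fixes x :: real
  assumes x: "0 \<le> x" "x < exp (- 1)"
  shows "summable (\<lambda>n. real n * tree_count n * x ^ n / fact n)"
    and "summable (\<lambda>n. tree_count n * x ^ n / fact n)"
proof -
  have geo: "summable (\<lambda>n. (exp 1 * x) ^ n)"
    using x by (intro summable_geometric) (simp add: exp_minus field_simps)
  have bound: "real n * tree_count n * x ^ n / fact n \<le> (exp 1 * x) ^ n" for n
  proof -
    have "real n * tree_count n \<le> real n ^ n"
    proof (cases n)
      case (Suc k)
      have "real n * tree_count n = real n ^ (Suc (n - 2))" using Suc by (simp add: tree_count_def)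
      also have "\<dots> \<le> real n ^ n" using Suc by (intro power_increasing) auto
      finally show ?thesis .
    qed (simp add: tree_count_def)
    then have "real n * tree_count n * x ^ n / fact n \<le> real n ^ n * x ^ n / fact n"
      using x by (intro divide_right_mono mult_right_mono) auto
    also have "\<dots> = real n ^ n / fact n * x ^ n" by simp
    also have "\<dots> \<le> exp (real n) * x ^ n"
      using x power_div_fact_le_exp[of "real n" n] by (intro mult_right_mono) auto
    also have "\<dots> = (exp 1 * x) ^ n"
      using exp_of_nat_mult[of n "1 :: real"] by (simp add: power_mult_distrib)
    finally show ?thesis .
  qed
  show "summable (\<lambda>n. real n * tree_count n * x ^ n / fact n)"
    using bound x by (intro summable_comparison_test'[OF geo]) auto
  have "tree_count n * x ^ n / fact n \<le> (exp 1 * x) ^ n" for n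
  proof -
    have "tree_count n \<le> real n * tree_count n"
      by (cases "n = 0") (auto simp: tree_count_def)
    then have "tree_count n * x ^ n / fact n \<le> real n * tree_count n * x ^ n / fact n"
      using x by (intro divide_right_mono mult_right_mono) auto
    then show ?thesis using bound[of n] by linarith
  qed
  then show "summable (\<lambda>n. tree_count n * x ^ n / fact n)"
    using x by (intro summable_comparison_test'[OF geo]) auto
qed

text \<open>With \<open>T\<close> and \<open>U\<close> the exponential generating functions of rooted and unrooted trees, the
  recursion reads \<open>T\<^sup>2 = 2 (T - U)\<close>, so \<open>U = (1 - (1 - T)\<^sup>2) / 2\<close>.\<close>

lemma tree_series_le_half:
  fixes x :: real
  assumes x: "0 \<le> x" "x \<le> exp (- 1)"
  shows "(\<Sum>n\<le>N. tree_count n * x ^ n / fact n) \<le> 1 / 2"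
proof -
  \<comment> \<open>The series identity is used strictly inside the interval; the endpoint is then
    reached by continuity of the partial sum.\<close>
  have less: "(\<Sum>n\<le>N. tree_count n * x ^ n / fact n) \<le> 1 / 2" if x: "0 \<le> x" "x < exp (- 1)" for x :: real
  proof -
    define a where "a n = real n * tree_count n * x ^ n / fact n" for n
    define u where "u n = tree_count n * x ^ n / fact n" for n
    have sa: "summable a" and su: "summable u"
      unfolding a_def u_def using tree_series_summable[OF x] by auto
    have a0: "a n \<ge> 0" "u n \<ge> 0" for n using x by (auto simp: a_def u_def)
    \<comment> \<open>This is \<open>abel_convolution\<close> divided by factorials, the coefficient
      form of the identity between \<open>T\<close> and \<open>U\<close>.\<close>
    have conv: "(\<Sum>k\<le>n. a k * a (n - k)) = 2 * (a n - u n)" for n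
    proof (cases "n = 0")
      case False
      define r where "r k = real k * real k ^ (k - 2)" for k :: nat
      have r: "real k * tree_count k = r k" for k by (simp add: tree_count_def r_def)
      have "a k * a (n - k) = x ^ n / fact n * ((n choose k) * (r k * r (n - k)))" if "k \<le> n" for k
      proof -
        have "real (n choose k) = fact n / (fact k * fact (n - k))"
          using that by (rule binomial_fact)
        moreover have "x ^ k * x ^ (n - k) = x ^ n" using that by (simp flip: power_add)
        ultimately show ?thesis
          unfolding a_def r by (simp add: field_simps)
      qed
      then have "(\<Sum>k\<le>n. a k * a (n - k)) = x ^ n / fact n * (\<Sum>k\<le>n. (n choose k) * (r k * r (n - k)))"
        by (simp add: sum_distrib_left)
      also have "\<dots> = x ^ n / fact n * (2 * (real n - 1) * tree_count n)"
        using abel_convolution[of n] False by (simp add: r_def tree_count_def)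
      finally show ?thesis by (simp add: a_def u_def field_simps)
    qed (simp add: a_def u_def tree_count_def)
    have "(suminf a)\<^sup>2 = (\<Sum>n. 2 * (a n - u n))"
      using Cauchy_product[of a a] sa a0 by (simp add: power2_eq_square conv)
    also have "\<dots> = 2 * (suminf a - suminf u)"
      by (simp only: suminf_mult[OF summable_diff[OF sa su]] suminf_diff[OF sa su])
    finally have "(1 - suminf a)\<^sup>2 = 1 - 2 * suminf u"
      by (simp add: power2_eq_square algebra_simps)
    then have "1 - 2 * suminf u \<ge> 0" by (metis zero_le_power2)
    then have "suminf u \<le> 1 / 2" by simp
    moreover have "(\<Sum>n\<le>N. u n) \<le> suminf u" using su a0 by (intro sum_le_suminf) auto
    ultimately show ?thesis by (simp add: u_def)
  qed
  show ?thesis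
  proof (cases "x = exp (- 1)")
    case True
    have "((\<lambda>x. \<Sum>n\<le>N. tree_count n * x ^ n / fact n) \<longlongrightarrow> (\<Sum>n\<le>N. tree_count n * x ^ n / fact n)) (at_left x)"
      by (intro tendsto_intros) auto
    moreover have "\<forall>\<^sub>F x in at_left x. (\<Sum>n\<le>N. tree_count n * x ^ n / fact n) \<le> 1 / 2"
      using less True by (auto simp: eventually_at_left_field intro!: exI[of _ 0])
    ultimately show ?thesis by (rule tendsto_upperbound) simp
  qed (use less x in auto)
qed

text \<open>The truncated generating functions satisfy \<open>G' \<le> U' G / q\<close>, so \<open>G exp (- U / q)\<close> decreases.\<close>

lemma forest_poly_coeff_le:
  fixes q x :: real
  assumes q: "q > 0" and x: "x \<ge> 0"
  shows "forest_poly q N / (fact N * q ^ N) * x ^ N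
    \<le> exp ((\<Sum>n\<le>N. tree_count n * x ^ n / fact n) / q)"
proof -
  \<comment> \<open>With this normalisation the recursion becomes a Cauchy product in which
    \<open>q\<close> survives only as one factor \<open>1 / q\<close>.\<close>
  define z where "z n = forest_poly q n / (fact n * q ^ n)" for n
  define c where "c k = tree_count (Suc k) / fact k" for k
  define G where "G x = (\<Sum>n\<le>N. z n * x ^ n)" for x
  define U where "U x = (\<Sum>n\<le>N. tree_count n / fact n * x ^ n)" for x
  have z0: "z n \<ge> 0" and c0: "c n \<ge> 0" for n
    using q by (auto simp: z_def c_def forest_poly_nonneg)
  have rec: "real (Suc n) * z (Suc n) = (\<Sum>k\<le>n. c k * z (n - k)) / q" for n
  proof -
    have "(n choose k) * tree_count (Suc k) * q ^ k * forest_poly q (n - k)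
        = fact n * q ^ n * (c k * z (n - k))" if "k \<le> n" for k
    proof -
      have "real (n choose k) = fact n / (fact k * fact (n - k))"
        using that by (rule binomial_fact)
      moreover have "q ^ n = q ^ k * q ^ (n - k)" using that by (simp flip: power_add)
      ultimately show ?thesis using q by (simp add: c_def z_def)
    qed
    then have "forest_poly q (Suc n) = fact n * q ^ n * (\<Sum>k\<le>n. c k * z (n - k))"
      by (simp add: forest_poly_Suc sum_distrib_left)
    then have "z (Suc n) = fact n * q ^ n * (\<Sum>k\<le>n. c k * z (n - k)) / (real (Suc n) * fact n * (q * q ^ n))"
      unfolding z_def[of "Suc n"] by simp
    then show ?thesis using q by simp
  qed
  define G' where "G' x = (\<Sum>n<N. real (Suc n) * z (Suc n) * x ^ n)" for x
  define U' where "U' x = (\<Sum>n<N. c n * x ^ n)" for x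
  have deriv_poly: "((\<lambda>x. \<Sum>n\<le>N. b n * x ^ n) has_real_derivative (\<Sum>n<N. real (Suc n) * b (Suc n) * x ^ n)) (at x)"
    for b and x :: real
  proof -
    have "((\<lambda>x. \<Sum>n\<le>N. b n * x ^ n) has_real_derivative (\<Sum>n\<le>N. b n * (real n * (x + 0) ^ (n - 1)))) (at x)"
      using DERIV_shifted_power[of 0] by (intro DERIV_sum DERIV_cmult) simp
    moreover have "(\<Sum>n\<le>N. b n * (real n * (x + 0) ^ (n - 1))) = (\<Sum>n<N. real (Suc n) * b (Suc n) * x ^ n)"
      by (subst sum.atMost_shift) (simp add: mult_ac)
    ultimately show ?thesis by simp
  qed
  have dG: "(G has_real_derivative G' x) (at x)" for x
    unfolding G_def G'_def by (rule deriv_poly)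
  have dU: "(U has_real_derivative U' x) (at x)" for x
  proof -
    have "real (Suc n) * (tree_count (Suc n) / fact (Suc n)) = c n" for n
      by (simp add: c_def del: of_nat_Suc)
    then show ?thesis using deriv_poly[of "\<lambda>n. tree_count n / fact n" x] by (simp only: U_def[abs_def] U'_def)
  qed
  have le: "G' x \<le> U' x * G x / q" if x: "x \<ge> 0" for x
  proof -
    have "G' x * q = (\<Sum>n<N. \<Sum>k\<le>n. (c k * x ^ k) * (z (n - k) * x ^ (n - k)))"
      unfolding G'_def rec sum_distrib_right
    proof (rule sum.cong[OF refl])
      fix n
      have "(\<Sum>k\<le>n. (c k * x ^ k) * (z (n - k) * x ^ (n - k))) = (\<Sum>k\<le>n. c k * z (n - k) * x ^ n)"
        by (rule sum.cong) (auto simp flip: power_add)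
      then show "(\<Sum>k\<le>n. c k * z (n - k)) / q * x ^ n * q = (\<Sum>k\<le>n. (c k * x ^ k) * (z (n - k) * x ^ (n - k)))"
        using q by (simp flip: sum_distrib_right)
    qed
    also have "\<dots> = (\<Sum>(i, j)\<in>{(i, j). i + j < N}. (c i * x ^ i) * (z j * x ^ j))"
      by (rule sum.triangle_reindex[symmetric])
    \<comment> \<open>The product of the truncated series has extra terms outside the triangle, all
      nonnegative; hence truncation turns the differential equation into an inequality in the
      required direction.\<close>
    also have "\<dots> \<le> (\<Sum>(i, j)\<in>{..<N} \<times> {..N}. (c i * x ^ i) * (z j * x ^ j))"
      using x z0 c0 by (intro sum_mono2) auto
    also have "\<dots> = U' x * G x"
      by (simp add: U'_def G_def sum_product sum.cartesian_product)
    finally show ?thesis using q by (simp add: field_simps)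
  qed
  define h where "h x = G x * exp (- U x / q)" for x
  have "h x \<le> h 0"
  proof (rule DERIV_nonpos_imp_nonincreasing[OF x])
    fix y assume y: "0 \<le> y" "y \<le> x"
    have "(h has_real_derivative G' y * exp (- U y / q) + exp (- U y / q) * (- U' y / q) * G y) (at y)"
      unfolding h_def by (intro DERIV_mult dG DERIV_fun_exp DERIV_cdivide DERIV_minus dU)
    moreover have "G' y * exp (- U y / q) + exp (- U y / q) * (- U' y / q) * G y
      = exp (- U y / q) * (G' y - U' y * G y / q)" by (simp add: algebra_simps)
    moreover have "\<dots> \<le> 0" using le[OF y(1)] by (intro mult_nonneg_nonpos) auto
    ultimately show "\<exists>d. (h has_real_derivative d) (at y) \<and> d \<le> 0" by auto
  qed
  also have "h 0 = 1"
    by (simp add: h_def G_def U_def z_def tree_count_def power_0_left sum.If_cases if_distrib cong: if_cong)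
  finally have "G x \<le> exp (U x / q)" by (simp add: h_def exp_minus field_simps)
  moreover have "z N * x ^ N \<le> G x"
    unfolding G_def using z0 x by (intro member_le_sum) auto
  ultimately show ?thesis by (simp add: z_def U_def)
qed

text \<open>The choice \<open>x = exp (- 1)\<close> is the right end of the range where the tree
  series is bounded by \<open>1 / 2\<close>; dividing by \<open>x ^ n\<close> then costs
  \<open>exp (real n)\<close>.\<close>

lemma forest_poly_le:
  assumes q: "q > 0"
  shows "forest_poly q n \<le> fact n * q ^ n * exp (real n + 1 / (2 * q))"
proof -
  define x where "x = exp (- 1 :: real)"
  have x: "0 \<le> x" "x \<le> exp (- 1)" by (auto simp: x_def)
  have xn: "x ^ n = exp (- real n)" by (simp add: x_def flip: exp_of_nat_mult)
  have "forest_poly q n / (fact n * q ^ n) * x ^ n \<le> exp ((1 / 2) / q)"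
    using forest_poly_coeff_le[OF q x(1), of n] tree_series_le_half[OF x, of n] q
    by (smt (verit) divide_right_mono exp_le_cancel_iff)
  then have "forest_poly q n / (fact n * q ^ n) \<le> exp ((1 / 2) / q) * exp (real n)"
    unfolding xn exp_minus by (simp only: divide_inverse[symmetric] pos_divide_le_eq exp_gt_zero)
  then have "forest_poly q n \<le> exp ((1 / 2) / q) * exp (real n) * (fact n * q ^ n)"
    using q by (simp only: pos_divide_le_eq fact_gt_zero zero_less_power mult_pos_pos)
  then show ?thesis by (simp add: exp_add mult_ac)
qed

section \<open>Harris' inequality and the subcritical regime\<close>

lemma reach_imp_distinct_path:
  assumes "(a, b) \<in> reach F"
  shows "\<exists>vs. vs \<noteq> [] \<and> distinct vs \<and> hd vs = a \<and> last vs = b \<and>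
    (\<forall>i < length vs - 1. {vs ! i, vs ! Suc i} \<in> F)"
  using assms
proof (induction rule: reach_induct)
  case refl
  show ?case by (rule exI[of _ "[a]"]) simp
next
  case (step x y)
  then obtain vs where vs: "vs \<noteq> []" "distinct vs" "hd vs = a" "last vs = x"
    "\<forall>i < length vs - 1. {vs ! i, vs ! Suc i} \<in> F" by auto
  show ?case
  proof (cases "y \<in> set vs")
    \<comment> \<open>The walk returns to a vertex already on the path, so the path is cut off
      there.\<close>
    case True
    then obtain k where k: "k < length vs" "vs ! k = y" by (auto simp: in_set_conv_nth)
    then have "last (take (Suc k) vs) = y" by (simp add: take_Suc_conv_app_nth)
    then show ?thesis
      by (intro exI[of _ "take (Suc k) vs"]) (use vs k in auto)
  next
    case False
    have "{(vs @ [y]) ! i, (vs @ [y]) ! Suc i} \<in> F" if "i < length vs" for i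
    proof (cases "Suc i < length vs")
      case True
      then show ?thesis using vs(5) by (simp add: nth_append)
    next
      case False
      then have "i = length vs - 1" using that by auto
      then show ?thesis using vs step.hyps that by (simp add: nth_append last_conv_nth)
    qed
    then show ?thesis
      by (intro exI[of _ "vs @ [y]"]) (use vs False in auto)
  qed
qed

text \<open>The closing edge of a cycle is bypassed by the rest of the cycle. Conversely, an edge
  that is not a bridge closes a path between its endpoints to a cycle.\<close>

lemma graph_acyclic_iff_forest:
  assumes E: "E \<subseteq> pairs S"
  shows "graph_acyclic E \<longleftrightarrow> forest E"
proof -
  have "\<not> forest E" if "has_cycle E"
  proof -
    from that obtain vs where vs: "length vs \<ge> 3" "distinct vs"
      "\<forall>i < length vs - 1. {vs ! i, vs ! Suc i} \<in> E" "{last vs, hd vs} \<in> E"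
      by (auto simp: has_cycle_def)
    let ?e = "{hd vs, last vs}"
    have ne: "vs \<noteq> []" using vs by auto
    have "(hd vs, vs ! i) \<in> reach (E - {?e})" if "i < length vs" for i
      using that
    proof (induction i)
      case 0
      then show ?case using ne by (simp add: hd_conv_nth)
    next
      case (Suc i)
      \<comment> \<open>By distinctness a path edge could equal the closing edge only if the list
        had length 2.\<close>
      have "{vs ! i, vs ! Suc i} \<noteq> ?e"
      proof
        assume "{vs ! i, vs ! Suc i} = ?e"
        then have "{vs ! i, vs ! Suc i} = {vs ! 0, vs ! (length vs - 1)}"
          using ne by (simp add: hd_conv_nth last_conv_nth)
        then have "i = 0 \<and> Suc i = length vs - 1"
          using vs(1) ne Suc.prems nth_eq_iff_index_eq[OF vs(2), of i 0]
            nth_eq_iff_index_eq[OF vs(2), of "Suc i" 0]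
            nth_eq_iff_index_eq[OF vs(2), of "Suc i" "length vs - 1"]
          by (auto simp: doubleton_eq_iff)
        then show False using vs by auto
      qed
      then have "{vs ! i, vs ! Suc i} \<in> E - {?e}" using vs Suc.prems by auto
      then show ?case using Suc by (auto intro: reach_trans reach_edge)
    qed
    from this[of "length vs - 1"] have "(hd vs, last vs) \<in> reach (E - {?e})"
      using ne by (simp add: last_conv_nth)
    moreover have "?e \<in> E" using vs by (simp add: insert_commute)
    ultimately show ?thesis by (auto simp: forest_def)
  qed
  moreover have "has_cycle E" if "\<not> forest E"
  proof -
    from that obtain u v where uv: "{u, v} \<in> E" "(u, v) \<in> reach (E - {{u, v}})"
      by (auto simp: forest_def)
    obtain vs where vs: "vs \<noteq> []" "distinct vs" "hd vs = u" "last vs = v"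
      "\<forall>i < length vs - 1. {vs ! i, vs ! Suc i} \<in> E - {{u, v}}"
      using reach_imp_distinct_path[OF uv(2)] by auto
    \<comment> \<open>Length 1 would force \<open>u = v\<close>, and length 2 would use the removed
      edge itself.\<close>
    have "length vs \<noteq> 1" "length vs \<noteq> 2" "length vs \<noteq> 0"
      using vs edgeD(3)[OF uv(1) E] by (auto simp: length_Suc_conv numeral_2_eq_2)
    then have "length vs \<ge> 3" by linarith
    then show ?thesis
      unfolding has_cycle_def using vs uv by (intro exI[of _ vs]) (auto simp: insert_commute)
  qed
  ultimately show ?thesis by (auto simp: graph_acyclic_def)
qed

section \<open>Expectations over a random subset and Harris' inequality\<close>

definition bernoulli_sum :: "real \<Rightarrow> 'a set \<Rightarrow> ('a set \<Rightarrow> real) \<Rightarrow> real" where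
  "bernoulli_sum p S f = (\<Sum>E\<in>Pow S. p ^ card E * (1 - p) ^ (card S - card E) * f E)"

lemma bernoulli_sum_empty [simp]: "bernoulli_sum p {} f = f {}"
  by (simp add: bernoulli_sum_def)

text \<open>Conditioning on whether \<open>e\<close> is chosen; the inductions on \<open>S\<close>
  below rest on this.\<close>

lemma bernoulli_sum_insert:
  assumes "finite S" "e \<notin> S"
  shows "bernoulli_sum p (insert e S) f
    = p * bernoulli_sum p S (\<lambda>E. f (insert e E)) + (1 - p) * bernoulli_sum p S f"
proof -
  have inj: "inj_on (insert e) (Pow S)" using assms by (auto simp: inj_on_def)
  have "Pow S \<inter> insert e ` Pow S = {}" using assms by auto
  then have "bernoulli_sum p (insert e S) f
    = (\<Sum>E\<in>Pow S. p ^ card E * (1 - p) ^ (Suc (card S) - card E) * f E)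
    + (\<Sum>E\<in>Pow S. p ^ card (insert e E) * (1 - p) ^ (Suc (card S) - card (insert e E)) * f (insert e E))"
    unfolding bernoulli_sum_def Pow_insert using assms inj
    by (subst sum.union_disjoint) (auto simp: sum.reindex)
  also have "(\<Sum>E\<in>Pow S. p ^ card E * (1 - p) ^ (Suc (card S) - card E) * f E) = (1 - p) * bernoulli_sum p S f"
    unfolding bernoulli_sum_def sum_distrib_left
    using assms by (intro sum.cong) (auto simp: Suc_diff_le card_mono)
  also have "(\<Sum>E\<in>Pow S. p ^ card (insert e E) * (1 - p) ^ (Suc (card S) - card (insert e E)) * f (insert e E))
    = p * bernoulli_sum p S (\<lambda>E. f (insert e E))"
    unfolding bernoulli_sum_def sum_distrib_left
  proof (intro sum.cong refl)
    fix E assume "E \<in> Pow S"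
    then have "finite E" "e \<notin> E" using assms finite_subset[of E S] by auto
    then show "p ^ card (insert e E) * (1 - p) ^ (Suc (card S) - card (insert e E)) * f (insert e E)
      = p * (p ^ card E * (1 - p) ^ (card S - card E) * f (insert e E))" by simp
  qed
  finally show ?thesis by simp
qed

lemma bernoulli_sum_const: "finite S \<Longrightarrow> bernoulli_sum p S (\<lambda>_. c) = c"
  by (induction S rule: finite_induct) (simp_all add: bernoulli_sum_insert algebra_simps)

lemma bernoulli_sum_cong:
  "(\<And>E. E \<subseteq> S \<Longrightarrow> f E = g E) \<Longrightarrow> bernoulli_sum p S f = bernoulli_sum p S g"
  by (auto simp: bernoulli_sum_def intro!: sum.cong)

lemma bernoulli_sum_mono:
  assumes "0 \<le> p" "p \<le> 1" "\<And>E. E \<subseteq> S \<Longrightarrow> f E \<le> g E"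
  shows "bernoulli_sum p S f \<le> bernoulli_sum p S g"
  unfolding bernoulli_sum_def using assms by (intro sum_mono mult_left_mono) auto

lemma bernoulli_sum_diff:
  "bernoulli_sum p S (\<lambda>E. f E - g E) = bernoulli_sum p S f - bernoulli_sum p S g"
  by (simp add: bernoulli_sum_def right_diff_distrib sum_subtractf)

lemma bernoulli_sum_superset:
  assumes "finite S" "A \<subseteq> S"
  shows "bernoulli_sum p S (\<lambda>E. of_bool (A \<subseteq> E)) = p ^ card A"
  using assms
proof (induction S arbitrary: A rule: finite_induct)
  case (insert e S)
  show ?case
  proof (cases "e \<in> A")
    case True
    have fA: "finite A" using insert.prems insert.hyps finite_subset by auto
    have "bernoulli_sum p S (\<lambda>E. of_bool (A \<subseteq> E)) = bernoulli_sum p S (\<lambda>_. 0)"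
      using True insert.hyps by (intro bernoulli_sum_cong) auto
    moreover have "bernoulli_sum p S (\<lambda>E. of_bool (A \<subseteq> insert e E)) = bernoulli_sum p S (\<lambda>E. of_bool (A - {e} \<subseteq> E))"
      by (intro bernoulli_sum_cong) auto
    moreover have "\<dots> = p ^ card (A - {e})" using insert.prems by (intro insert.IH) auto
    moreover have "p * p ^ card (A - {e}) = p ^ card A"
      using card_Suc_Diff1[OF fA True] by (metis power_Suc)
    ultimately show ?thesis
      using insert.hyps by (simp add: bernoulli_sum_insert bernoulli_sum_const)
  next
    case False
    then have A: "A \<subseteq> S" using insert.prems by auto
    have "bernoulli_sum p S (\<lambda>E. of_bool (A \<subseteq> insert e E)) = bernoulli_sum p S (\<lambda>E. of_bool (A \<subseteq> E))"
      using False by (intro bernoulli_sum_cong) auto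
    then show ?thesis
      using insert.hyps insert.IH[OF A] by (simp add: bernoulli_sum_insert algebra_simps)
  qed
qed simp

text \<open>Conditioning on \<open>e\<close>, the induction hypothesis handles each of the two
  cases. What remains is the covariance of the two conditional expectations,
  \<open>p * (1 - p)\<close> times a product of two differences that are nonnegative because
  \<open>f\<close> and \<open>g\<close> decrease.\<close>

lemma harris_inequality:
  assumes "finite S" and p: "0 \<le> p" "p \<le> 1"
    and "\<And>A B. A \<subseteq> B \<Longrightarrow> B \<subseteq> S \<Longrightarrow> f B \<le> f A" "\<And>A B. A \<subseteq> B \<Longrightarrow> B \<subseteq> S \<Longrightarrow> g B \<le> g A"
  shows "bernoulli_sum p S f * bernoulli_sum p S g \<le> bernoulli_sum p S (\<lambda>E. f E * g E)"
  using assms(1,4,5)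
proof (induction S arbitrary: f g rule: finite_induct)
  case (insert e S)
  define f1 g1 where "f1 = (\<lambda>E. f (insert e E))" and "g1 = (\<lambda>E. g (insert e E))"
  let ?b = "bernoulli_sum p S"
  have 1: "?b f1 * ?b g1 \<le> ?b (\<lambda>E. f1 E * g1 E)"
    unfolding f1_def g1_def by (rule insert.IH; rule insert.prems) auto
  have 0: "?b f * ?b g \<le> ?b (\<lambda>E. f E * g E)"
    by (rule insert.IH; rule insert.prems) auto
  have "?b f1 \<le> ?b f" "?b g1 \<le> ?b g"
    unfolding f1_def g1_def by (rule bernoulli_sum_mono[OF p]; rule insert.prems; auto)+
  then have "0 \<le> p * (1 - p) * ((?b f - ?b f1) * (?b g - ?b g1))"
    using p by (intro mult_nonneg_nonneg) auto
  then have "(p * ?b f1 + (1 - p) * ?b f) * (p * ?b g1 + (1 - p) * ?b g)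
      \<le> p * (?b f1 * ?b g1) + (1 - p) * (?b f * ?b g)"
    by (simp add: algebra_simps)
  also have "\<dots> \<le> p * ?b (\<lambda>E. f1 E * g1 E) + (1 - p) * ?b (\<lambda>E. f E * g E)"
    using 0 1 p by (intro add_mono mult_left_mono) auto
  finally show ?case
    using insert.hyps by (simp add: bernoulli_sum_insert f1_def g1_def)
qed simp

text \<open>Each event of not containing \<open>A i\<close> is decreasing and has probability
  \<open>1 - p ^ card (A i)\<close>, so Harris' inequality can be applied once per index.\<close>

lemma bernoulli_sum_avoid_ge:
  assumes S: "finite S" and p: "0 \<le> p" "p \<le> 1" and I: "finite I" and A: "\<And>i. i \<in> I \<Longrightarrow> A i \<subseteq> S"
  shows "(\<Prod>i\<in>I. 1 - p ^ card (A i)) \<le> bernoulli_sum p S (\<lambda>E. of_bool (\<forall>i\<in>I. \<not> A i \<subseteq> E))"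
  using I A
proof (induction I rule: finite_induct)
  case (insert i I)
  let ?f = "\<lambda>E. of_bool (\<not> A i \<subseteq> E) :: real" and ?g = "\<lambda>E. of_bool (\<forall>i\<in>I. \<not> A i \<subseteq> E) :: real"
  have "bernoulli_sum p S ?f = bernoulli_sum p S (\<lambda>E. 1 - of_bool (A i \<subseteq> E))"
    by (intro bernoulli_sum_cong) auto
  also have "\<dots> = 1 - p ^ card (A i)"
    using insert.prems S by (simp add: bernoulli_sum_diff bernoulli_sum_const bernoulli_sum_superset)
  finally have f: "bernoulli_sum p S ?f = 1 - p ^ card (A i)" .
  have "(\<Prod>i\<in>insert i I. 1 - p ^ card (A i)) \<le> bernoulli_sum p S ?f * bernoulli_sum p S ?g"
    using insert p by (simp add: f mult_left_mono power_le_one)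
  also have "\<dots> \<le> bernoulli_sum p S (\<lambda>E. ?f E * ?g E)"
    by (rule harris_inequality[OF S p]) (auto simp: of_bool_def, blast)
  finally show ?case by (simp flip: of_bool_conj)
qed (simp add: bernoulli_sum_const S)

section \<open>The probability of having no cycle below the threshold\<close>

lemma all_pairs_conv_pairs: "all_pairs n = pairs {1..n}"
  by (simp add: all_pairs_def pairs_def)

lemma gnp_prob_conv_bernoulli_sum:
  "gnp_prob n p Q = bernoulli_sum p (all_pairs n) (\<lambda>E. of_bool (Q E))"
proof -
  have eq: "{E. E \<subseteq> all_pairs n \<and> Q E} = {E \<in> Pow (all_pairs n). Q E}" by auto
  show ?thesis
    unfolding gnp_prob_def bernoulli_sum_def eq
    by (rule trans[OF sum.inter_filter sum.cong]) (auto simp: all_pairs_conv_pairs)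
qed

lemma gnp_prob_le_1: "0 \<le> p \<Longrightarrow> p \<le> 1 \<Longrightarrow> gnp_prob n p Q \<le> 1"
  using bernoulli_sum_mono[of p "all_pairs n" "\<lambda>E. of_bool (Q E)" "\<lambda>_. 1"]
  by (simp add: gnp_prob_conv_bernoulli_sum bernoulli_sum_const all_pairs_conv_pairs)

definition cycle_edges :: "'a list \<Rightarrow> 'a set set" where
  "cycle_edges vs = insert {last vs, hd vs} ((\<lambda>i. {vs ! i, vs ! Suc i}) ` {..<length vs - 1})"

lemma card_cycle_edges:
  assumes "distinct vs" "length vs \<ge> 3"
  shows "card (cycle_edges vs) = length vs"
proof -
  have ne: "vs \<noteq> []" using assms by auto
  have "inj_on (\<lambda>i. {vs ! i, vs ! Suc i}) {..<length vs - 1}"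
    using assms by (auto simp: inj_on_def doubleton_eq_iff nth_eq_iff_index_eq)
  moreover have "{last vs, hd vs} \<notin> (\<lambda>i. {vs ! i, vs ! Suc i}) ` {..<length vs - 1}"
    using assms ne by (auto simp: doubleton_eq_iff nth_eq_iff_index_eq hd_conv_nth last_conv_nth)
  ultimately show ?thesis
    using assms by (simp add: cycle_edges_def card_image)
qed

lemma cycle_edges_subset:
  assumes "distinct vs" "length vs \<ge> 3" "set vs \<subseteq> V"
  shows "cycle_edges vs \<subseteq> pairs V"
proof -
  have ne: "vs \<noteq> []" using assms by auto
  have "vs ! i \<in> V" if "i < length vs" for i using that assms by auto
  then show ?thesis
    using assms ne by (auto simp: cycle_edges_def hd_conv_nth last_conv_nth nth_eq_iff_index_eq)
qed

text \<open>Vertices of a cycle are endpoints of edges and so lie in \<open>V\<close>. For finite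
  \<open>V\<close> this leaves finitely many lists to avoid, as
  \<open>bernoulli_sum_avoid_ge\<close> demands.\<close>

lemma has_cycle_iff:
  assumes E: "E \<subseteq> pairs V"
  shows "has_cycle E \<longleftrightarrow> (\<exists>vs. distinct vs \<and> length vs \<ge> 3 \<and> set vs \<subseteq> V \<and> cycle_edges vs \<subseteq> E)"
proof -
  have "set vs \<subseteq> V" if "length vs \<ge> 3" "\<forall>i < length vs - 1. {vs ! i, vs ! Suc i} \<in> E" for vs
  proof
    fix x assume "x \<in> set vs"
    then obtain i where i: "i < length vs" "vs ! i = x" by (auto simp: in_set_conv_nth)
    show "x \<in> V"
    proof (cases "i < length vs - 1")
      case True
      then show ?thesis using that i edgeD(1)[of "vs ! i" "vs ! Suc i" E V] E by auto
    next
      case False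
      then have "Suc (i - 1) = i" "i - 1 < length vs - 1" using i that by auto
      then show ?thesis using that i edgeD(2)[of "vs ! (i - 1)" "vs ! Suc (i - 1)" E V] E by auto
    qed
  qed
  then show ?thesis
    unfolding has_cycle_def cycle_edges_def insert_subset image_subset_iff lessThan_iff by auto
qed

text \<open>On this range
  \<open>(1 - x) * (1 + 2 * x) = 1 + x * (1 - 2 * x) \<ge> 1\<close>.\<close>

lemma exp_minus_double_le:
  fixes x :: real
  assumes "0 \<le> x" "x \<le> 1 / 2" shows "exp (- 2 * x) \<le> 1 - x"
proof -
  have "1 \<le> (1 - x) * (1 + 2 * x)"
    using assms mult_nonneg_nonneg[of x "1 - 2 * x"] by (simp add: algebra_simps)
  also have "\<dots> \<le> (1 - x) * exp (2 * x)"
    using assms exp_ge_add_one_self[of "2 * x"] by (intro mult_left_mono) auto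
  finally show ?thesis by (simp add: exp_minus field_simps)
qed

text \<open>Harris' inequality over all vertex lists that trace a cycle. A cycle is listed once per
  starting point and direction, which only lowers the product. With at most \<open>n ^ k\<close>
  lists of length \<open>k\<close> the exponents are bounded by a geometric series in \<theta>, so
  the bound is uniform in \<open>n\<close>.\<close>

lemma acyclic_prob_ge:
  assumes p: "0 \<le> p" "p \<le> 1 / 2" and \<theta>: "real n * p \<le> \<theta>" "\<theta> < 1"
  shows "exp (- 2 / (1 - \<theta>)) \<le> gnp_prob n p graph_acyclic"
proof -
  define I where "I = {vs. distinct vs \<and> length vs \<ge> 3 \<and> set vs \<subseteq> {1..n}}"
  have len: "length vs \<le> n" if "vs \<in> I" for vs
    using that card_mono[of "{1..n}" "set vs"] by (auto simp: I_def distinct_card)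
  have fin: "finite I"
    by (rule finite_subset[OF _ finite_lists_length_le[of "{1..n}" n]]) (use len in \<open>auto simp: I_def\<close>)
  have \<theta>0: "0 \<le> \<theta>" using p \<theta> by (meson mult_nonneg_nonneg of_nat_0_le_iff order_trans)
  have "(\<Sum>vs\<in>I. p ^ length vs) = (\<Sum>k\<le>n. \<Sum>vs | vs \<in> I \<and> length vs = k. p ^ length vs)"
    using fin len by (intro sum.group[symmetric]) auto
  also have "\<dots> \<le> (\<Sum>k\<le>n. \<theta> ^ k)"
  proof (rule sum_mono)
    fix k
    have "card {vs \<in> I. length vs = k} \<le> card {vs. set vs \<subseteq> {1..n} \<and> length vs = k}"
      by (intro card_mono finite_lists_length_eq) (auto simp: I_def)
    then have "real (card {vs \<in> I. length vs = k}) \<le> real n ^ k"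
      by (simp add: card_lists_length_eq flip: of_nat_power)
    then have "real (card {vs \<in> I. length vs = k}) * p ^ k \<le> real n ^ k * p ^ k"
      using p by (intro mult_right_mono) auto
    also have "\<dots> = (real n * p) ^ k" by (simp add: power_mult_distrib)
    also have "\<dots> \<le> \<theta> ^ k" using \<theta> p by (intro power_mono) auto
    finally show "(\<Sum>vs | vs \<in> I \<and> length vs = k. p ^ length vs) \<le> \<theta> ^ k" by simp
  qed
  also have "\<dots> \<le> (\<Sum>k. \<theta> ^ k)"
    using \<theta> \<theta>0 by (intro sum_le_suminf summable_geometric) auto
  also have "\<dots> = 1 / (1 - \<theta>)" using \<theta> \<theta>0 by (intro suminf_geometric) auto
  finally have "exp (- 2 / (1 - \<theta>)) \<le> exp (\<Sum>vs\<in>I. - 2 * p ^ length vs)"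
    by (simp add: sum_distrib_left[symmetric] sum_negf)
  also have "\<dots> = (\<Prod>vs\<in>I. exp (- 2 * p ^ length vs))" using fin by (rule exp_sum)
  also have "\<dots> \<le> (\<Prod>vs\<in>I. 1 - p ^ card (cycle_edges vs))"
  proof (rule prod_mono)
    fix vs assume vs: "vs \<in> I"
    have "p ^ length vs \<le> p ^ 1" using p vs by (intro power_decreasing) (auto simp: I_def)
    then have "exp (- 2 * p ^ length vs) \<le> 1 - p ^ length vs"
      using p by (intro exp_minus_double_le) auto
    then show "0 \<le> exp (- 2 * p ^ length vs) \<and> exp (- 2 * p ^ length vs) \<le> 1 - p ^ card (cycle_edges vs)"
      using vs by (auto simp: I_def card_cycle_edges)
  qed
  also have "\<dots> \<le> bernoulli_sum p (pairs {1..n}) (\<lambda>E. of_bool (\<forall>vs\<in>I. \<not> cycle_edges vs \<subseteq> E))"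
    using p fin cycle_edges_subset by (intro bernoulli_sum_avoid_ge) (auto simp: I_def)
  also have "\<dots> = gnp_prob n p graph_acyclic"
    unfolding gnp_prob_conv_bernoulli_sum all_pairs_conv_pairs
    by (intro bernoulli_sum_cong) (auto simp: graph_acyclic_def has_cycle_iff I_def)
  finally show ?thesis .
qed

section \<open>Asymptotics\<close>

lemma acyclic_prob_conv_forest_poly:
  assumes "p < 1"
  shows "gnp_prob n p graph_acyclic = (1 - p) ^ (n choose 2) * forest_poly (p / (1 - p)) n"
proof -
  have "{E. E \<subseteq> all_pairs n \<and> graph_acyclic E} = forests {1..n}"
    by (auto simp: all_pairs_conv_pairs forests_def graph_acyclic_iff_forest)
  then have "gnp_prob n p graph_acyclic
    = (\<Sum>E\<in>forests {1..n}. p ^ card E * (1 - p) ^ (card (all_pairs n) - card E))"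
    by (simp add: gnp_prob_def)
  also have "\<dots> = (\<Sum>E\<in>forests {1..n}. (1 - p) ^ (n choose 2) * (p / (1 - p)) ^ card E)"
  proof (rule sum.cong[OF refl])
    fix E assume "E \<in> forests {1..n}"
    then have "card E \<le> n choose 2"
      using card_mono[of "pairs {1..n}" E] by (simp add: forests_def card_pairs)
    then have "(1 - p) ^ (n choose 2) = (1 - p) ^ (card (all_pairs n) - card E) * (1 - p) ^ card E"
      by (simp add: all_pairs_conv_pairs card_pairs flip: power_add)
    then show "p ^ card E * (1 - p) ^ (card (all_pairs n) - card E)
      = (1 - p) ^ (n choose 2) * (p / (1 - p)) ^ card E"
      using assms by (simp add: power_divide)
  qed
  finally show ?thesis by (simp add: forest_poly_def forest_weight_def sum_distrib_left)
qed

text \<open>The bounds for \<alpha> \<ge> 1 are brought into the form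
  \<open>exp (real n * x)\<close> so that the \<open>n\<close>-th root can be read off.\<close>

lemma root_exp_nat_mult: "n > 0 \<Longrightarrow> root n (exp (real n * x)) = exp x"
  by (simp add: exp_of_nat_mult real_root_power_cancel)

lemma real_choose_2: "real (n choose 2) = real n * (real n - 1) / 2"
  by (induction n) (auto simp: numeral_2_eq_2 field_simps)

lemma power_choose_2:
  assumes "p < 1"
  shows "(1 - p) ^ (n choose 2) = exp (real n * ((real n - 1) / 2 * ln (1 - p)))"
proof -
  have "(1 - p) ^ (n choose 2) = exp (ln (1 - p)) ^ (n choose 2)" using assms by simp
  also have "\<dots> = exp (real (n choose 2) * ln (1 - p))" by (rule exp_of_nat_mult[symmetric])
  finally show ?thesis by (simp add: real_choose_2 mult_ac)
qed

text \<open>Here \<open>q = \<alpha> / (n - \<alpha>)\<close>. The powers of e from Stirling and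
  from \<open>forest_poly_le\<close> cancel up to one factor; the four summands come from the power
  of \<open>1 - p\<close>, the Stirling excess \<open>exp 1 * n\<close>, \<open>(n * q) ^ n\<close>
  and \<open>exp (1 / (2 * q))\<close>.\<close>

lemma acyclic_prob_le:
  assumes \<alpha>: "\<alpha> > 0" and n: "real n > \<alpha>"
  shows "gnp_prob n (\<alpha> / n) graph_acyclic \<le> exp (real n * ((real n - 1) / 2 * ln (1 - \<alpha> / n)
    + ln (exp 1 * n) / n + ln (\<alpha> * n / (n - \<alpha>)) + (n - \<alpha>) / (2 * \<alpha> * n)))"
proof -
  define p q where "p = \<alpha> / n" and "q = p / (1 - p)"
  have n0: "n > 0" "real n > 0" using \<alpha> n by (auto intro: gr0I)
  have p: "0 < p" "p < 1" using \<alpha> n n0 by (auto simp: p_def)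
  have q: "q > 0" using p by (simp add: q_def)
  have q_eq: "q = \<alpha> / (n - \<alpha>)" using \<alpha> n n0 by (simp add: q_def p_def field_simps)
  have "forest_poly q n \<le> fact n * q ^ n * exp (real n + 1 / (2 * q))"
    by (rule forest_poly_le[OF q])
  also have "\<dots> \<le> (real n ^ Suc n * exp (1 - real n)) * q ^ n * exp (real n + 1 / (2 * q))"
    using fact_le_power_exp[OF n0(1)] q by (intro mult_right_mono) auto
  also have "\<dots> = (exp 1 * real n) * (real n * q) ^ n * exp (1 / (2 * q))"
    by (simp add: power_mult_distrib exp_add exp_diff)
  also have "exp 1 * real n = exp (real n * (ln (exp 1 * n) / n))" using n0 by simp
  also have "(real n * q) ^ n = exp (real n * ln (\<alpha> * n / (n - \<alpha>)))"
    using \<alpha> n n0 by (simp add: exp_of_nat_mult q_eq mult.commute)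
  also have "exp (1 / (2 * q)) = exp (real n * ((n - \<alpha>) / (2 * \<alpha> * n)))"
    using \<alpha> n0 by (simp add: q_eq field_simps)
  finally have "(1 - p) ^ (n choose 2) * forest_poly q n \<le>
    exp (real n * ((real n - 1) / 2 * ln (1 - p))) * (exp (real n * (ln (exp 1 * n) / n)) *
      exp (real n * ln (\<alpha> * n / (n - \<alpha>))) * exp (real n * ((n - \<alpha>) / (2 * \<alpha> * n))))"
    unfolding power_choose_2[OF p(2)] by (intro mult_left_mono) auto
  also have "\<dots> = exp (real n * ((real n - 1) / 2 * ln (1 - p)
    + ln (exp 1 * n) / n + ln (\<alpha> * n / (n - \<alpha>)) + (n - \<alpha>) / (2 * \<alpha> * n)))"
    by (simp only: distrib_left exp_add mult.assoc)
  finally show ?thesis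
    using acyclic_prob_conv_forest_poly[OF p(2), of n] by (simp only: p_def[symmetric] q_def[symmetric])
qed

section \<open>Lower bound from a single large tree\<close>

lemma forest_poly_ge_term:
  assumes "q \<ge> 0" "k < n"
  shows "(n - 1 choose k) * real (n - k) ^ (n - k - 2) * q ^ (n - k - 1) * forest_poly q k \<le> forest_poly q n"
proof -
  obtain N where N: "n = Suc N" using assms by (cases n) auto
  define f where "f j = (N choose j) * tree_count (Suc j) * q ^ j * forest_poly q (N - j)" for j
  \<comment> \<open>Only the forests are kept in which the component of the marked vertex has
    \<open>n - k\<close> vertices.\<close>
  have "f (N - k) \<le> sum f {..N}"
    using assms by (intro member_le_sum) (auto simp: f_def forest_poly_nonneg)
  moreover have "N choose (N - k) = N choose k" "Suc (N - k) = n - k" "N - (N - k) = k"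
    using assms N binomial_symmetric[of k N] by auto
  ultimately show ?thesis
    using assms N by (simp add: f_def forest_poly_Suc tree_count_def)
qed

text \<open>With \<open>M = n - k\<close>, Stirling's bounds leave
  \<open>(n / k) ^ k * \<alpha> ^ M\<close> up to polynomial factors, because the powers
  \<open>M ^ M\<close> cancel. Then \<open>k * \<alpha> \<le> n\<close> yields
  \<open>\<alpha> ^ n\<close>, and the denominator collects losses that vanish in the
  \<open>n\<close>-th root.\<close>

lemma giant_tree_term_ge:
  assumes \<alpha>: "\<alpha> \<ge> 1" and k: "0 < k" "k < n" "real k * \<alpha> \<le> n"
  shows "\<alpha> ^ n / (\<alpha> * exp 2 * real n ^ 3)
    \<le> (n - 1 choose k) * real (n - k) ^ (n - k - 2) * (\<alpha> / n) ^ (n - k - 1)"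
proof -
  obtain j where j: "n - k = Suc j" using k by (cases "n - k") auto
  define M where "M = Suc j"
  have n: "n = Suc (j + k)" using j k by simp
  have pos: "real n > 0" "real M > 0" "real k > 0" using n k by (auto simp: M_def)
  have choose: "real (n - 1 choose k) = fact n / (fact k * fact M) * (real M / real n)"
  proof -
    have "real (n - 1 choose k) = fact (j + k) / (fact k * fact j)"
      using binomial_fact[of k "n - 1"] n by simp
    moreover have "fact n = real n * fact (j + k)" "fact M = real M * fact j"
      by (simp_all add: n M_def)
    ultimately show ?thesis using pos by simp
  qed
  have "fact k * fact M \<le> (real k ^ Suc k * exp (1 - real k)) * (real M ^ Suc M * exp (1 - real M))"
    using k by (intro mult_mono fact_le_power_exp) (auto simp: M_def)
  also have "\<dots> = real k ^ Suc k * real M ^ Suc M * (exp (1 - real k) * exp (1 - real M))"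
    by simp
  also have "exp (1 - real k) * exp (1 - real M) = exp 2 / exp (real n)"
    unfolding exp_add[symmetric] exp_diff[symmetric] by (simp add: n M_def)
  finally have den: "fact k * fact M \<le> real k ^ Suc k * real M ^ Suc M * (exp 2 / exp (real n))" .
  have num: "real n ^ n / exp (real n) \<le> fact n"
    using power_div_fact_le_exp[of "real n" n] by (simp add: field_simps)
  have "(real n ^ n / exp (real n)) / (real k ^ Suc k * real M ^ Suc M * (exp 2 / exp (real n)))
      \<le> fact n / (fact k * fact M)"
    using num den by (intro frac_le) auto
  moreover have "(real n ^ n / exp (real n)) / (real k ^ Suc k * real M ^ Suc M * (exp 2 / exp (real n)))
      = real n ^ n / (exp 2 * real k ^ Suc k * real M ^ Suc M)"
    by simp
  ultimately have "real n ^ n / (exp 2 * real k ^ Suc k * real M ^ Suc M) \<le> fact n / (fact k * fact M)"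
    by (simp only:)
  then have "real n ^ n / (exp 2 * real k ^ Suc k * real M ^ Suc M) * (real M / real n * real M ^ (M - 2) * (\<alpha> / n) ^ j)
      \<le> fact n / (fact k * fact M) * (real M / real n * real M ^ (M - 2) * (\<alpha> / n) ^ j)"
    using \<alpha> by (intro mult_right_mono) auto
  also have "\<dots> = (n - 1 choose k) * real (n - k) ^ (n - k - 2) * (\<alpha> / n) ^ (n - k - 1)"
    unfolding choose by (simp add: j M_def)
  finally have 1: "real n ^ n / (exp 2 * real k ^ Suc k * real M ^ Suc M) * (real M / real n * real M ^ (M - 2) * (\<alpha> / n) ^ j)
      \<le> (n - 1 choose k) * real (n - k) ^ (n - k - 2) * (\<alpha> / n) ^ (n - k - 1)" .
  have "real n ^ n = real n ^ k * (real n * real n ^ j)" by (simp add: n power_add)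
  moreover have "real M * real M ^ (M - 2) = real M ^ j" by (cases j) (auto simp: M_def)
  moreover have "real M ^ Suc M = real M ^ j * real M ^ 2" by (simp add: M_def power2_eq_square)
  ultimately have 2: "real n ^ n / (exp 2 * real k ^ Suc k * real M ^ Suc M) * (real M / real n * real M ^ (M - 2) * (\<alpha> / n) ^ j)
      = real n ^ k * \<alpha> ^ j / (exp 2 * real k ^ Suc k * real M ^ 2)"
    using pos by (simp add: power_divide)
  \<comment> \<open>The extra \<alpha> in the denominator appears because the tree has
    \<open>j\<close> edges while \<open>n = j + k + 1\<close>.\<close>
  have "\<alpha> ^ n / (\<alpha> * exp 2 * real n ^ 3) = \<alpha> ^ k * \<alpha> ^ j / (exp 2 * real n ^ 3)"
    using \<alpha> by (simp add: n power_add)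
  also have "\<dots> \<le> \<alpha> ^ k * \<alpha> ^ j / (exp 2 * (real k * real M ^ 2))"
  proof -
    have "real k * real M ^ 2 \<le> real n * real n ^ 2"
      using k n by (intro mult_mono power_mono) (auto simp: M_def)
    then show ?thesis
      using pos \<alpha> by (intro divide_left_mono mult_left_mono) (auto simp: power3_eq_cube power2_eq_square)
  qed
  also have "\<dots> = (real k * \<alpha>) ^ k * \<alpha> ^ j / (exp 2 * real k ^ Suc k * real M ^ 2)"
    using pos by (simp add: power_mult_distrib)
  also have "\<dots> \<le> real n ^ k * \<alpha> ^ j / (exp 2 * real k ^ Suc k * real M ^ 2)"
    using k \<alpha> pos by (intro divide_right_mono mult_right_mono power_mono) auto
  finally show ?thesis using 1 unfolding 2 by linarith
qed

text \<open>One tree on \<open>n - k\<close> vertices together with a slightly subcritical forest on the other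
  \<open>k \<approx> \<theta> n / \<alpha>\<close> vertices already accounts for the exponential rate as \<open>\<theta> \<rightarrow> 1\<close>.\<close>

lemma acyclic_prob_ge_giant:
  assumes \<alpha>: "\<alpha> \<ge> 1" and \<theta>: "0 < \<theta>" "\<theta> < 1" and n: "real n \<ge> 2 * \<alpha>" "\<theta> * n / \<alpha> \<ge> 2"
  shows "exp (real n * ((real n - 1) / 2 * ln (1 - \<alpha> / n) + ln \<alpha> - ln (\<alpha> * exp 2 * real n ^ 3) / n
      - 2 / (1 - \<theta>) / n + \<alpha> / n * ((\<theta> * n / \<alpha> - 1) * (\<theta> * n / \<alpha> - 2) / 2) / n))
    \<le> gnp_prob n (\<alpha> / n) graph_acyclic"
proof -
  define p q where "p = \<alpha> / n" and "q = p / (1 - p)"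
  \<comment> \<open>The largest \<open>k\<close> with \<open>k * p \<le> \<theta>\<close>, so that
    \<open>acyclic_prob_ge\<close> applies to the remaining vertices.\<close>
  define k where "k = nat \<lfloor>\<theta> * n / \<alpha>\<rfloor>"
  have n0: "real n > 0" using \<alpha> n by linarith
  have p: "0 < p" "p \<le> 1 / 2" "p < 1" using \<alpha> n n0 by (auto simp: p_def field_simps)
  have q: "p \<le> q" "0 \<le> q" using p by (auto simp: q_def field_simps)
  have k_bounds: "real k \<le> \<theta> * n / \<alpha>" "\<theta> * n / \<alpha> - 1 \<le> real k"
    unfolding k_def using n by linarith+
  have "\<theta> * n / \<alpha> < n / 1"
    using \<theta> \<alpha> n0 by (simp add: field_simps)
  then have k: "0 < k" "k < n" using k_bounds n by linarith+
  have "real k * \<alpha> \<le> \<theta> * n" using k_bounds(1) \<alpha> by (simp add: field_simps)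
  moreover have "\<theta> * n \<le> n" using \<theta> n0 by simp
  ultimately have k\<alpha>: "real k * \<alpha> \<le> n" "real k * p \<le> \<theta>"
    using n0 by (linarith, simp add: p_def field_simps)
  have choose_k: "(\<theta> * n / \<alpha> - 1) * (\<theta> * n / \<alpha> - 2) / 2 \<le> real (k choose 2)"
    unfolding real_choose_2 using k_bounds n by (intro divide_right_mono mult_mono) auto
  \<comment> \<open>The probability bound is converted back to a weight: dividing by
    \<open>(1 - p) ^ (k choose 2)\<close> gains \<open>exp (p * (k choose 2))\<close>, whose
    exponent is about \<open>n * \<theta> ^ 2 / (2 * \<alpha>)\<close>.\<close>
  have "exp (- 2 / (1 - \<theta>)) \<le> (1 - p) ^ (k choose 2) * forest_poly q k"
    using acyclic_prob_ge[of p k \<theta>] p k\<alpha> \<theta> acyclic_prob_conv_forest_poly[of p k] by (simp add: q_def)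
  also have "\<dots> \<le> exp (- p) ^ (k choose 2) * forest_poly q k"
    using p q exp_ge_add_one_self[of "- p"]
    by (intro mult_right_mono power_mono) (auto simp: forest_poly_nonneg)
  also have "exp (- p) ^ (k choose 2) = exp (- (p * real (k choose 2)))"
    by (simp flip: exp_of_nat_mult add: mult.commute)
  finally have "exp (- 2 / (1 - \<theta>)) * exp (p * real (k choose 2)) \<le> forest_poly q k"
    by (simp add: exp_minus field_simps)
  moreover have "exp (p * ((\<theta> * n / \<alpha> - 1) * (\<theta> * n / \<alpha> - 2) / 2)) \<le> exp (p * real (k choose 2))"
    using choose_k p by (simp only: exp_le_cancel_iff) (intro mult_left_mono, auto)
  ultimately have fk: "exp (- 2 / (1 - \<theta>)) * exp (p * ((\<theta> * n / \<alpha> - 1) * (\<theta> * n / \<alpha> - 2) / 2)) \<le> forest_poly q k"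
    by (meson exp_ge_zero mult_left_mono order_trans)
  have "\<alpha> ^ n / (\<alpha> * exp 2 * real n ^ 3)
      \<le> (n - 1 choose k) * real (n - k) ^ (n - k - 2) * p ^ (n - k - 1)"
    using giant_tree_term_ge[OF \<alpha> k k\<alpha>(1)] by (simp add: p_def)
  also have "\<dots> \<le> (n - 1 choose k) * real (n - k) ^ (n - k - 2) * q ^ (n - k - 1)"
    using p q by (intro mult_left_mono power_mono) auto
  finally have "\<alpha> ^ n / (\<alpha> * exp 2 * real n ^ 3) *
      (exp (- 2 / (1 - \<theta>)) * exp (p * ((\<theta> * n / \<alpha> - 1) * (\<theta> * n / \<alpha> - 2) / 2)))
    \<le> (n - 1 choose k) * real (n - k) ^ (n - k - 2) * q ^ (n - k - 1) * forest_poly q k"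
    using fk q \<alpha> by (intro mult_mono) auto
  also have "\<dots> \<le> forest_poly q n" by (rule forest_poly_ge_term[OF q(2) k(2)])
  finally have "(1 - p) ^ (n choose 2) * (\<alpha> ^ n / (\<alpha> * exp 2 * real n ^ 3) *
      (exp (- 2 / (1 - \<theta>)) * exp (p * ((\<theta> * n / \<alpha> - 1) * (\<theta> * n / \<alpha> - 2) / 2))))
    \<le> (1 - p) ^ (n choose 2) * forest_poly q n"
    using p by (intro mult_left_mono) auto
  moreover have "\<alpha> ^ n = exp (real n * ln \<alpha>)" using \<alpha> by (simp add: exp_of_nat_mult)
  moreover have "\<alpha> * exp 2 * real n ^ 3 = exp (real n * (ln (\<alpha> * exp 2 * real n ^ 3) / n))"
    using \<alpha> n0 by simp
  moreover have "exp (- 2 / (1 - \<theta>)) = exp (real n * (- 2 / (1 - \<theta>) / n))" using n0 by simp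
  moreover have "exp (p * ((\<theta> * n / \<alpha> - 1) * (\<theta> * n / \<alpha> - 2) / 2))
      = exp (real n * (p * ((\<theta> * n / \<alpha> - 1) * (\<theta> * n / \<alpha> - 2) / 2) / n))" using n0 by simp
  ultimately have "exp (real n * ((real n - 1) / 2 * ln (1 - p))) *
      (exp (real n * ln \<alpha>) / exp (real n * (ln (\<alpha> * exp 2 * real n ^ 3) / n)) *
      (exp (real n * (- 2 / (1 - \<theta>) / n)) *
       exp (real n * (p * ((\<theta> * n / \<alpha> - 1) * (\<theta> * n / \<alpha> - 2) / 2) / n))))
    \<le> gnp_prob n p graph_acyclic"
    using acyclic_prob_conv_forest_poly[OF p(3), of n] unfolding power_choose_2[OF p(3)] q_def[symmetric]
    by simp
  moreover have "exp (real n * ((real n - 1) / 2 * ln (1 - p))) *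
      (exp (real n * ln \<alpha>) / exp (real n * (ln (\<alpha> * exp 2 * real n ^ 3) / n)) *
      (exp (real n * (- 2 / (1 - \<theta>) / n)) *
       exp (real n * (p * ((\<theta> * n / \<alpha> - 1) * (\<theta> * n / \<alpha> - 2) / 2) / n))))
    = exp (real n * ((real n - 1) / 2 * ln (1 - p) + ln \<alpha> - ln (\<alpha> * exp 2 * real n ^ 3) / n
      - 2 / (1 - \<theta>) / n + p * ((\<theta> * n / \<alpha> - 1) * (\<theta> * n / \<alpha> - 2) / 2) / n))"
    unfolding exp_add[symmetric] exp_diff[symmetric] by (simp only: right_diff_distrib distrib_left) simp
  ultimately show ?thesis by (simp only: p_def)
qed

section \<open>Limits of the exponential rates\<close>

lemma eventually_acyclic_root_less:
  assumes \<alpha>: "\<alpha> > 0" and b: "\<alpha> * exp (- \<alpha> / 2 + 1 / (2 * \<alpha>)) < b"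
  shows "\<forall>\<^sub>F n in sequentially. root n (gnp_prob n (\<alpha> / n) graph_acyclic) < b"
proof -
  define g where "g n = (real n - 1) / 2 * ln (1 - \<alpha> / n) + ln (exp 1 * n) / n + ln (\<alpha> * n / (n - \<alpha>))
    + (n - \<alpha>) / (2 * \<alpha> * n)" for n :: nat
  \<comment> \<open>The summands tend to \<open>- \<alpha> / 2\<close>, 0,
    \<open>ln \<alpha>\<close> and \<open>1 / (2 * \<alpha>)\<close> in this order.\<close>
  have "g \<longlonglongrightarrow> - \<alpha> / 2 + ln \<alpha> + 1 / (2 * \<alpha>)"
    unfolding g_def using \<alpha> by (real_asymp simp: field_simps)
  then have "(\<lambda>n. exp (g n)) \<longlonglongrightarrow> exp (- \<alpha> / 2 + ln \<alpha> + 1 / (2 * \<alpha>))" by (rule tendsto_exp)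
  also have "exp (- \<alpha> / 2 + ln \<alpha> + 1 / (2 * \<alpha>)) = \<alpha> * exp (- \<alpha> / 2 + 1 / (2 * \<alpha>))"
    using \<alpha> by (simp add: exp_add exp_diff)
  finally have "\<forall>\<^sub>F n in sequentially. exp (g n) < b" using b by (rule order_tendstoD)
  moreover have "\<forall>\<^sub>F n in sequentially. real n > \<alpha>" by real_asymp
  ultimately show ?thesis
  proof eventually_elim
    case (elim n)
    then have "n > 0" using \<alpha> by (auto intro: gr0I)
    then have "root n (gnp_prob n (\<alpha> / n) graph_acyclic) \<le> exp (g n)"
      using acyclic_prob_le[OF \<alpha> elim(2)] root_exp_nat_mult[of n "g n"] real_root_le_mono
      unfolding g_def by metis
    then show ?case using elim by linarith
  qed
qed

lemma eventually_acyclic_root_greater: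
  assumes \<alpha>: "\<alpha> \<ge> 1" and a: "a < \<alpha> * exp (- \<alpha> / 2 + 1 / (2 * \<alpha>))"
  shows "\<forall>\<^sub>F n in sequentially. a < root n (gnp_prob n (\<alpha> / n) graph_acyclic)"
proof -
  \<comment> \<open>A fixed \<theta> below 1 is chosen first, close enough to 1 for its rate to
    exceed \<open>a\<close>; only then does \<open>n\<close> tend to infinity.\<close>
  have "((\<lambda>\<theta>. \<alpha> * exp (- \<alpha> / 2 + \<theta>\<^sup>2 / (2 * \<alpha>))) \<longlongrightarrow> \<alpha> * exp (- \<alpha> / 2 + 1\<^sup>2 / (2 * \<alpha>))) (at_left 1)"
    using \<alpha> by (intro tendsto_intros) auto
  then have "\<forall>\<^sub>F \<theta> in at_left 1. a < \<alpha> * exp (- \<alpha> / 2 + \<theta>\<^sup>2 / (2 * \<alpha>))"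
    using a by (intro order_tendstoD(1)) auto
  moreover have "\<forall>\<^sub>F \<theta> in at_left (1::real). \<theta> \<in> {0<..<1}"
    by (rule eventually_at_left_real) simp
  ultimately have "\<forall>\<^sub>F \<theta> in at_left 1. a < \<alpha> * exp (- \<alpha> / 2 + \<theta>\<^sup>2 / (2 * \<alpha>)) \<and> \<theta> \<in> {0<..<1}"
    by eventually_elim auto
  then obtain \<theta> where \<theta>: "a < \<alpha> * exp (- \<alpha> / 2 + \<theta>\<^sup>2 / (2 * \<alpha>))" "0 < \<theta>" "\<theta> < 1"
    using eventually_happens[of _ "at_left (1::real)"] by auto
  define c where "c = 2 / (1 - \<theta>)"
  define g where "g n = (real n - 1) / 2 * ln (1 - \<alpha> / n) + ln \<alpha> - ln (\<alpha> * exp 2 * real n ^ 3) / n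
      - c / n + \<alpha> / n * ((\<theta> * n / \<alpha> - 1) * (\<theta> * n / \<alpha> - 2) / 2) / n" for n :: nat
  have \<alpha>0: "\<alpha> > 0" using \<alpha> by simp
  have "g \<longlonglongrightarrow> - \<alpha> / 2 + ln \<alpha> + \<theta>\<^sup>2 / (2 * \<alpha>)"
    unfolding g_def using \<alpha>0 \<theta>(2) by (real_asymp simp: power2_eq_square field_simps)
  then have "(\<lambda>n. exp (g n)) \<longlonglongrightarrow> exp (- \<alpha> / 2 + ln \<alpha> + \<theta>\<^sup>2 / (2 * \<alpha>))" by (rule tendsto_exp)
  also have "exp (- \<alpha> / 2 + ln \<alpha> + \<theta>\<^sup>2 / (2 * \<alpha>)) = \<alpha> * exp (- \<alpha> / 2 + \<theta>\<^sup>2 / (2 * \<alpha>))"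
    using \<alpha>0 by (simp add: exp_add exp_diff)
  finally have "\<forall>\<^sub>F n in sequentially. a < exp (g n)" using \<theta>(1) by (rule order_tendstoD)
  moreover have "\<forall>\<^sub>F n in sequentially. real n \<ge> 2 * \<alpha>" by real_asymp
  moreover have "\<forall>\<^sub>F n in sequentially. \<theta> * real n / \<alpha> \<ge> 2" using \<theta> \<alpha>0 by real_asymp
  ultimately show ?thesis
  proof eventually_elim
    case (elim n)
    then have "n > 0" using \<alpha> by (auto intro: gr0I)
    then have "exp (g n) \<le> root n (gnp_prob n (\<alpha> / n) graph_acyclic)"
      using acyclic_prob_ge_giant[OF \<alpha> \<theta>(2,3) elim(2,3)] root_exp_nat_mult[of n "g n"] real_root_le_mono
      unfolding g_def c_def by metis
    then show ?case using elim by linarith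
  qed
qed

theorem theorem2p3:
  fixes \<alpha> :: real
  assumes "\<alpha> \<ge> 0"
  shows "(\<lambda>n. root n (gnp_prob n (\<alpha> / real n) graph_acyclic))
           \<longlonglongrightarrow> (if \<alpha> > 1 then \<alpha> * exp (- \<alpha> / 2 + 1 / (2 * \<alpha>)) else 1)"
proof -
  have upper: "\<forall>\<^sub>F n in sequentially. root n (gnp_prob n (\<alpha> / n) graph_acyclic) \<le> 1"
  proof -
    have "\<forall>\<^sub>F n in sequentially. real n > \<alpha>" by real_asymp
    then show ?thesis
    proof eventually_elim
      case (elim n)
      then have "n > 0" using assms by (auto intro: gr0I)
      moreover have "gnp_prob n (\<alpha> / n) graph_acyclic \<le> 1"
        using assms elim by (intro gnp_prob_le_1) auto
      ultimately show ?case by simp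
    qed
  qed
  consider "\<alpha> > 1" | "\<alpha> = 1" | "\<alpha> < 1" by linarith
  then show ?thesis
  proof cases
    case 1
    then show ?thesis
      using eventually_acyclic_root_less[of \<alpha>] eventually_acyclic_root_greater[of \<alpha>]
      by (intro order_tendstoI) auto
  next
    case 2
    \<comment> \<open>At \<alpha> = 1 the formula takes the value 1, so the lower bound by a large
      tree meets the trivial upper bound.\<close>
    have "\<forall>\<^sub>F n in sequentially. a < root n (gnp_prob n (\<alpha> / n) graph_acyclic)" if "a < 1" for a
      using eventually_acyclic_root_greater[of \<alpha> a] 2 that by simp
    moreover have "\<forall>\<^sub>F n in sequentially. root n (gnp_prob n (\<alpha> / n) graph_acyclic) < b" if "1 < b" for b
      using upper by eventually_elim (use that in linarith)
    ultimately have "(\<lambda>n. root n (gnp_prob n (\<alpha> / real n) graph_acyclic)) \<longlonglongrightarrow> 1"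
      by (intro order_tendstoI) auto
    then show ?thesis using 2 by simp
  next
    case 3
    define c where "c = - 2 / (1 - \<alpha>)"
    have "(\<lambda>n. exp (c / real n)) \<longlonglongrightarrow> 1" by real_asymp
    moreover have "\<forall>\<^sub>F n in sequentially. exp (c / real n) \<le> root n (gnp_prob n (\<alpha> / n) graph_acyclic)"
      \<comment> \<open>From \<open>n = 2\<close> on, \<alpha> < 1 gives
        \<open>\<alpha> / n \<le> 1 / 2\<close>, as \<open>acyclic_prob_ge\<close> requires.\<close>
      using eventually_ge_at_top[of 2]
    proof eventually_elim
      case (elim n)
      then have "exp c \<le> gnp_prob n (\<alpha> / n) graph_acyclic"
        unfolding c_def using assms 3 by (intro acyclic_prob_ge) (auto simp: field_simps)
      then have "root n (exp (real n * (c / n))) \<le> root n (gnp_prob n (\<alpha> / n) graph_acyclic)"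
        using elim by (intro real_root_le_mono) auto
      then show ?case using elim by (subst (asm) root_exp_nat_mult) auto
    qed
    ultimately have "(\<lambda>n. root n (gnp_prob n (\<alpha> / real n) graph_acyclic)) \<longlonglongrightarrow> 1"
      using upper by (intro tendsto_sandwich[OF _ upper _ tendsto_const]) auto
    then show ?thesis using 3 by simp
  qed
qed

end
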